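(* Let $\Gamma$ be a Coxeter graph. Let $\widehat{PVA}[\Gamma]$ be the group with generators $\{\hat\zeta_\beta\mid\beta\in\Phi[\Gamma]\}$ and relations $Z(\gamma,\beta,\hat m_{\beta,\gamma})=Z(\beta,\gamma,\hat m_{\beta,\gamma})$ for all $\beta,\gamma\in\Phi[\Gamma]$ with $\beta\neq\gamma$ and $\hat m_{\beta,\gamma}\neq\infty$. Then the map $\hat\zeta_\beta\mapsto\zeta_\beta$ induces an isomorphism $\widehat{PVA}[\Gamma]\to PVA[\Gamma]$.
   Context: A Coxeter matrix on a countable set $S$ is a symmetric matrix $M=(m_{s,t})_{s,t\in S}$ with entries in $\mathbb{N}\cup\{\infty\}$ such that $m_{s,s}=1$ for all $s$ and $m_{s,t}=m_{t,s}\ge 2$ for $s\neq t$; it is encoded by a Coxeter graph $\Gamma$ with vertex set $S$ ($\Gamma$ is called finite if $S$ is finite). For letters $a,b$ and an integer $m\ge 2$, $\Pi_L(a,b,m)$ denotes the alternating word $aba\cdots$ of length $m$ beginning with $a$, and $\Pi_R(b,a,m)$ denotes the alternating word $\cdots aba$ of length $m$ ending with $a$; the same notation denotes the elements these words represent in a group. The Artin group $A[\Gamma]$ is given by the presentation $\langle S\mid \Pi_R(t,s,m_{s,t})=\Pi_R(s,t,m_{s,t})\text{ for } s\neq t,\ m_{s,t}\neq\infty\rangle$, and the Coxeter group $W[\Gamma]$ is the quotient of $A[\Gamma]$ by the relations $s^2=1$, $s\in S$. The virtual Artin group $VA[\Gamma]$ is the group generated by two sets $\{\sigma_s\mid s\in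 S\}$ and $\{\tau_s\mid s\in S\}$ in bijection with $S$, subject to the following relations, for all $s,t\in S$ with $s\neq t$ and $m_{s,t}\neq\infty$: (v1) $\Pi_R(\sigma_t,\sigma_s,m_{s,t})=\Pi_R(\sigma_s,\sigma_t,m_{s,t})$; (v2) $\Pi_R(\tau_t,\tau_s,m_{s,t})=\Pi_R(\tau_s,\tau_t,m_{s,t})$, together with $\tau_s^2=1$ for all $s\in S$; (v3) $\Pi_R(\tau_s,\tau_t,m_{s,t}-1)\,\sigma_s=\sigma_r\,\Pi_R(\tau_s,\tau_t,m_{s,t}-1)$, where $r=s$ if $m_{s,t}$ is even and $r=t$ if $m_{s,t}$ is odd. We have homomorphisms $\iota_A:A[\Gamma]\to VA[\Gamma]$, $s\mapsto\sigma_s$; $\iota_W:W[\Gamma]\to VA[\Gamma]$, $s\mapsto\tau_s$; $\pi_K:VA[\Gamma]\to W[\Gamma]$, $\sigma_s\mapsto 1$, $\tau_s\mapsto s$; and $\pi_P:VA[\Gamma]\to W[\Gamma]$, $\sigma_s\mapsto s$, $\tau_s\mapsto s$. Set $KVA[\Gamma]=\ker\pi_K$ and $PVA[\Gamma]=\ker\pi_P$. Let $V$ be the real vector space with basis $\{\alpha_s\mid s\in S\}$ (simple roots), with the canonical symmetric bilinear form $\langle\alpha_s,\alpha_t\rangle=-2\cos(\pi/m_{s,t})$ if $m_{s,t}\neq\infty$ and $=-2$ if $m_{s,t}=\infty$. $W[\Gamma]$ acts faithfully on $V$ by $s(v)=v-\langle v,\alpha_s\rangle\alpha_s$. The root system is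 $\Phi[\Gamma]=\{w(\alpha_s)\mid w\in W[\Gamma],s\in S\}$. For $\beta\in\Phi[\Gamma]$, $r_\beta\in W[\Gamma]$ is the reflection $v\mapsto v-\langle v,\beta\rangle\beta$. For $w\in W[\Gamma]$ and $g\in KVA[\Gamma]$ or $PVA[\Gamma]$ write $w\cdot g=\iota_W(w)g\iota_W(w)^{-1}$. For $\beta\in\Phi[\Gamma]$ choose $w\in W[\Gamma]$, $s\in S$ with $w(\alpha_s)=\beta$ and set $\delta_\beta=w\cdot\sigma_s\in KVA[\Gamma]$ and $\zeta_\beta=w\cdot(\tau_s\sigma_s)\in PVA[\Gamma]$ (these do not depend on the choice of $w,s$). Define the Coxeter matrix $\hat M=(\hat m_{\beta,\gamma})_{\beta,\gamma\in\Phi[\Gamma]}$ by $\hat m_{\beta,\beta}=1$, and for $\beta\neq\gamma$: $\hat m_{\beta,\gamma}=m_{s,t}$ if there exist $w\in W[\Gamma]$, $s,t\in S$ with $\beta=w(\alpha_s)$, $\gamma=w(\alpha_t)$, $m_{s,t}\neq\infty$ (this value is independent of choices), and $\hat m_{\beta,\gamma}=\infty$ otherwise. $\hat\Gamma$ is the Coxeter graph of $\hat M$ (vertex set $\Phi[\Gamma]$). For $\beta,\gamma\in\Phi[\Gamma]$ with $\hat m_{\beta,\gamma}=m\neq\infty$, define roots $\beta_1=\beta$ and for $2\le k\le m$: $\beta_k=\Pi_R(r_\gamma,r_\beta,k-1)(\gamma)$ if $k$ is even, $\beta_k=\Pi_R(r_\beta,r_\gamma,k-1)(\beta)$ if $k$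 is odd; and let $Z(\gamma,\beta,m)$ be the word $\hat\zeta_{\beta_m}\cdots\hat\zeta_{\beta_2}\hat\zeta_{\beta_1}$ over an abstract alphabet $\{\hat\zeta_\beta\mid\beta\in\Phi[\Gamma]\}$ in bijection with $\Phi[\Gamma]$. ($Z(\beta,\gamma,m)$ is defined by exchanging $\beta$ and $\gamma$.) *)

theory Defs
  imports Complex_Main "HOL-Library.Extended_Nat" "HOL-Library.Countable_Set"
    "HOL-Algebra.Coset"
begin

text \<open>A word over generators of type 'g: a letter (True, x) stands for x,
  a letter (False, x) for the inverse of x.\<close>
type_synonym 'g word = "(bool \<times> 'g) list"

definition inv_word :: "'g word \<Rightarrow> 'g word" where
  "inv_word w = rev (map (\<lambda>(b, x). (\<not> b, x)) w)"

definition word_subst :: "('g \<Rightarrow> 'h word) \<Rightarrow> 'g word \<Rightarrow> 'h word" where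
  "word_subst f w = concat (map (\<lambda>(b, x). if b then f x else inv_word (f x)) w)"

inductive_set pres_rel :: "'g set \<Rightarrow> ('g word \<times> 'g word) set \<Rightarrow> ('g word \<times> 'g word) set"
  for X :: "'g set" and R :: "('g word \<times> 'g word) set" where
  pr_refl: "w \<in> lists (UNIV \<times> X) \<Longrightarrow> (w, w) \<in> pres_rel X R"
| pr_sym: "(u, v) \<in> pres_rel X R \<Longrightarrow> (v, u) \<in> pres_rel X R"
| pr_trans: "(u, v) \<in> pres_rel X R \<Longrightarrow> (v, w) \<in> pres_rel X R \<Longrightarrow> (u, w) \<in> pres_rel X R"
| pr_cancel: "x \<in> X \<Longrightarrow> ([(b, x), (\<not> b, x)], []) \<in> pres_rel X R"
| pr_rel: "(u, v) \<in> R \<Longrightarrow> (u, v) \<in> pres_rel X R"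
| pr_concat: "(u, v) \<in> pres_rel X R \<Longrightarrow> (u', v') \<in> pres_rel X R \<Longrightarrow> (u @ u', v @ v') \<in> pres_rel X R"

definition presented_group :: "'g set \<Rightarrow> ('g word \<times> 'g word) set \<Rightarrow> 'g word set monoid" where
  "presented_group X R =
     \<lparr> carrier = lists (UNIV \<times> X) // pres_rel X R,
       mult = (\<lambda>A B. pres_rel X R `` {(SOME a. a \<in> A) @ (SOME b. b \<in> B)}),
       one = pres_rel X R `` {[]} \<rparr>"

definition induced_map ::
  "'h set \<Rightarrow> ('h word \<times> 'h word) set \<Rightarrow> ('g \<Rightarrow> 'h word) \<Rightarrow> 'g word set \<Rightarrow> 'h word set" where
  "induced_map Y Q f A = pres_rel Y Q `` {word_subst f (SOME a. a \<in> A)}"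

fun altword :: "'h \<Rightarrow> 'h \<Rightarrow> nat \<Rightarrow> 'h list" where
  "altword b a 0 = []"
| "altword b a (Suc m) = altword a b m @ [a]"

fun altR :: "('v \<Rightarrow> 'v) \<Rightarrow> ('v \<Rightarrow> 'v) \<Rightarrow> nat \<Rightarrow> 'v \<Rightarrow> 'v" where
  "altR b a 0 = id"
| "altR b a (Suc m) = altR a b m \<circ> a"

definition pos :: "'h list \<Rightarrow> 'h word" where
  "pos xs = map (\<lambda>x. (True, x)) xs"

definition coxeter_matrix :: "'s set \<Rightarrow> ('s \<Rightarrow> 's \<Rightarrow> enat) \<Rightarrow> bool" where
  "coxeter_matrix S M \<longleftrightarrow>
     (\<forall>s\<in>S. M s s = 1) \<and>
     (\<forall>s\<in>S. \<forall>t\<in>S. s \<noteq> t \<longrightarrow> M s t = M t s \<and> M s t \<ge> 2)"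

definition W_rels :: "'s set \<Rightarrow> ('s \<Rightarrow> 's \<Rightarrow> enat) \<Rightarrow> ('s word \<times> 's word) set" where
  "W_rels S M =
     {(pos (altword t s m), pos (altword s t m)) | s t m.
        s \<in> S \<and> t \<in> S \<and> s \<noteq> t \<and> M s t = enat m}
   \<union> {(pos [s, s], []) | s. s \<in> S}"

definition W_grp :: "'s set \<Rightarrow> ('s \<Rightarrow> 's \<Rightarrow> enat) \<Rightarrow> 's word set monoid" where
  "W_grp S M = presented_group S (W_rels S M)"

text \<open>Virtual Artin group: generators Inl s = \<sigma>_s, Inr s = \<tau>_s.\<close>
definition VA_rels :: "'s set \<Rightarrow> ('s \<Rightarrow> 's \<Rightarrow> enat) \<Rightarrow> (('s + 's) word \<times> ('s + 's) word) set" where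
  "VA_rels S M =
     {(pos (altword (Inl t) (Inl s) m), pos (altword (Inl s) (Inl t) m)) | s t m.
        s \<in> S \<and> t \<in> S \<and> s \<noteq> t \<and> M s t = enat m}
   \<union> {(pos (altword (Inr t) (Inr s) m), pos (altword (Inr s) (Inr t) m)) | s t m.
        s \<in> S \<and> t \<in> S \<and> s \<noteq> t \<and> M s t = enat m}
   \<union> {(pos [Inr s, Inr s], []) | s. s \<in> S}
   \<union> {(pos (altword (Inr s) (Inr t) (m - 1) @ [Inl s]),
       pos ([Inl (if even m then s else t)] @ altword (Inr s) (Inr t) (m - 1))) | s t m.
        s \<in> S \<and> t \<in> S \<and> s \<noteq> t \<and> M s t = enat m}"

definition VA_grp :: "'s set \<Rightarrow> ('s \<Rightarrow> 's \<Rightarrow> enat) \<Rightarrow> ('s + 's) word set monoid" where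
  "VA_grp S M = presented_group (Inl ` S \<union> Inr ` S) (VA_rels S M)"

definition piP :: "'s set \<Rightarrow> ('s \<Rightarrow> 's \<Rightarrow> enat) \<Rightarrow> ('s + 's) word set \<Rightarrow> 's word set" where
  "piP S M = induced_map S (W_rels S M) (\<lambda>x. case x of Inl s \<Rightarrow> pos [s] | Inr s \<Rightarrow> pos [s])"

definition PVA_grp :: "'s set \<Rightarrow> ('s \<Rightarrow> 's \<Rightarrow> enat) \<Rightarrow> ('s + 's) word set monoid" where
  "PVA_grp S M = (VA_grp S M)\<lparr>carrier := kernel (VA_grp S M) (W_grp S M) (piP S M)\<rparr>"

text \<open>Vectors of V are finitely supported functions S \<rightarrow> real; \<alpha>_s is the
  indicator of s.\<close>
definition alpha :: "'s \<Rightarrow> 's \<Rightarrow> real" where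
  "alpha s = (\<lambda>t. if t = s then 1 else 0)"

definition bil_coeff :: "('s \<Rightarrow> 's \<Rightarrow> enat) \<Rightarrow> 's \<Rightarrow> 's \<Rightarrow> real" where
  "bil_coeff M s t = (case M s t of enat m \<Rightarrow> - 2 * cos (pi / real m) | \<infinity> \<Rightarrow> - 2)"

definition bil :: "('s \<Rightarrow> 's \<Rightarrow> enat) \<Rightarrow> ('s \<Rightarrow> real) \<Rightarrow> ('s \<Rightarrow> real) \<Rightarrow> real" where
  "bil M u v = (\<Sum>s\<in>{s. u s \<noteq> 0}. \<Sum>t\<in>{t. v t \<noteq> 0}. u s * v t * bil_coeff M s t)"

definition refl :: "('s \<Rightarrow> 's \<Rightarrow> enat) \<Rightarrow> ('s \<Rightarrow> real) \<Rightarrow> ('s \<Rightarrow> real) \<Rightarrow> ('s \<Rightarrow> real)" where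
  "refl M \<beta> v = (\<lambda>t. v t - bil M v \<beta> * \<beta> t)"

fun act :: "('s \<Rightarrow> 's \<Rightarrow> enat) \<Rightarrow> 's list \<Rightarrow> ('s \<Rightarrow> real) \<Rightarrow> ('s \<Rightarrow> real)" where
  "act M [] = id"
| "act M (s # w) = refl M (alpha s) \<circ> act M w"

definition roots :: "'s set \<Rightarrow> ('s \<Rightarrow> 's \<Rightarrow> enat) \<Rightarrow> ('s \<Rightarrow> real) set" where
  "roots S M = {act M w (alpha s) | w s. w \<in> lists S \<and> s \<in> S}"

definition zeta_word :: "'s set \<Rightarrow> ('s \<Rightarrow> 's \<Rightarrow> enat) \<Rightarrow> ('s \<Rightarrow> real) \<Rightarrow> ('s + 's) word" where
  "zeta_word S M \<beta> =
     (let (w, s) = (SOME (w, s). w \<in> lists S \<and> s \<in> S \<and> act M w (alpha s) = \<beta>)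
      in pos (map Inr w) @ pos [Inr s, Inl s] @ inv_word (pos (map Inr w)))"

definition hatM :: "'s set \<Rightarrow> ('s \<Rightarrow> 's \<Rightarrow> enat) \<Rightarrow> ('s \<Rightarrow> real) \<Rightarrow> ('s \<Rightarrow> real) \<Rightarrow> enat" where
  "hatM S M \<beta> \<gamma> =
     (if \<beta> = \<gamma> then 1
      else if (\<exists>w s t. w \<in> lists S \<and> s \<in> S \<and> t \<in> S \<and> \<beta> = act M w (alpha s)
                        \<and> \<gamma> = act M w (alpha t) \<and> M s t \<noteq> \<infinity>)
      then (SOME m. \<exists>w s t. w \<in> lists S \<and> s \<in> S \<and> t \<in> S \<and> \<beta> = act M w (alpha s)
                        \<and> \<gamma> = act M w (alpha t) \<and> M s t \<noteq> \<infinity> \<and> m = M s t)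
      else \<infinity>)"

text \<open>The roots \<beta>_k (k \<ge> 1) attached to (\<beta>, \<gamma>).\<close>
definition root_seq :: "('s \<Rightarrow> 's \<Rightarrow> enat) \<Rightarrow> ('s \<Rightarrow> real) \<Rightarrow> ('s \<Rightarrow> real) \<Rightarrow> nat \<Rightarrow> ('s \<Rightarrow> real)" where
  "root_seq M \<beta> \<gamma> k =
     (if odd k then altR (refl M \<beta>) (refl M \<gamma>) (k - 1) \<beta>
      else altR (refl M \<gamma>) (refl M \<beta>) (k - 1) \<gamma>)"

definition Zword :: "('s \<Rightarrow> 's \<Rightarrow> enat) \<Rightarrow> ('s \<Rightarrow> real) \<Rightarrow> ('s \<Rightarrow> real) \<Rightarrow> nat \<Rightarrow> ('s \<Rightarrow> real) word" where
  "Zword M \<gamma> \<beta> m = pos (map (root_seq M \<beta> \<gamma>) (rev [1..<Suc m]))"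

definition PVAhat_rels :: "'s set \<Rightarrow> ('s \<Rightarrow> 's \<Rightarrow> enat) \<Rightarrow> (('s \<Rightarrow> real) word \<times> ('s \<Rightarrow> real) word) set" where
  "PVAhat_rels S M =
     {(Zword M \<gamma> \<beta> m, Zword M \<beta> \<gamma> m) | \<beta> \<gamma> m.
        \<beta> \<in> roots S M \<and> \<gamma> \<in> roots S M \<and> \<beta> \<noteq> \<gamma> \<and> hatM S M \<beta> \<gamma> = enat m}"

definition PVAhat_grp :: "'s set \<Rightarrow> ('s \<Rightarrow> 's \<Rightarrow> enat) \<Rightarrow> ('s \<Rightarrow> real) word set monoid" where
  "PVAhat_grp S M = presented_group (roots S M) (PVAhat_rels S M)"

definition PVAhat_map :: "'s set \<Rightarrow> ('s \<Rightarrow> 's \<Rightarrow> enat) \<Rightarrow> ('s \<Rightarrow> real) word set \<Rightarrow> ('s + 's) word set" where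
  "PVAhat_map S M = induced_map (Inl ` S \<union> Inr ` S) (VA_rels S M) (zeta_word S M)"

end

theory Submission
  imports Defs
begin

text \<open>
  The Coxeter group \<open>W\<close> acts on the group with generators \<open>\<zeta>\<^sub>\<beta>\<close> by permuting the roots, and the
  virtual Artin group is the corresponding semidirect product via \<open>\<tau>\<^sub>s = s\<close>, \<open>\<sigma>\<^sub>s = s \<zeta>\<^sub>\<alpha>\<close> with
  \<open>\<alpha> = \<alpha>\<^sub>s\<close>; the projection onto \<open>W\<close> is \<open>\<pi>\<^sub>P\<close>. Instead of building the semidirect product, every word
  \<open>g\<close> of the virtual Artin group is split as \<open>\<tau>\<^sub>w \<zeta>(u)\<close>, and the factor \<open>u\<close> is shown to depend only on
  the class of \<open>g\<close>, which inverts the map of the theorem.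

  That \<open>\<zeta>\<^sub>\<beta>\<close> is well defined rests on two facts about the reflection representation, both
  obtained from the positivity of \<open>w(\<alpha>\<^sub>s)\<close> for \<open>l(ws) > l(w)\<close>: it is faithful, and an element that
  sends a simple root to a simple root is a product of elements of rank two parabolic subgroups
  doing the same, for which relation (v3) applies.
\<close>

declare in_lists_conv_set [simp del] in_listsD [rule del] in_listsI [rule del]

section \<open>The reflection representation\<close>

locale coxeter =
  fixes S :: "'s set" and M :: "'s \<Rightarrow> 's \<Rightarrow> enat"
  assumes coxeter_matrix: "coxeter_matrix S M"
begin

text \<open>The supports are kept finite and inside \<open>S\<close> because \<open>bil\<close> sums
  over supports, where an infinite sum would default to 0, and because symmetry of
  \<open>bil_coeff\<close> is known on \<open>S\<close> only.\<close>

definition V :: "('s \<Rightarrow> real) set" where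
  "V = {v. finite {s. v s \<noteq> 0} \<and> {s. v s \<noteq> 0} \<subseteq> S}"

lemma M_same: "s \<in> S \<Longrightarrow> M s s = 1"
  and M_sym: "s \<in> S \<Longrightarrow> t \<in> S \<Longrightarrow> M s t = M t s"
  and M_ge2: "s \<in> S \<Longrightarrow> t \<in> S \<Longrightarrow> s \<noteq> t \<Longrightarrow> 2 \<le> M s t"
  using coxeter_matrix unfolding coxeter_matrix_def by metis+

lemma M_enat_ge2: "s \<in> S \<Longrightarrow> t \<in> S \<Longrightarrow> s \<noteq> t \<Longrightarrow> M s t = enat m \<Longrightarrow> 2 \<le> m"
  using M_ge2[of s t] by (simp add: numeral_eq_enat)

lemma bil_coeff_sym: "s \<in> S \<Longrightarrow> t \<in> S \<Longrightarrow> bil_coeff M s t = bil_coeff M t s"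
  by (simp add: bil_coeff_def M_sym)

lemma bil_coeff_same: "s \<in> S \<Longrightarrow> bil_coeff M s s = 2"
  by (simp add: bil_coeff_def M_same one_enat_def)

text \<open>The support of a linear combination may shrink by cancellation; summing over a common
  finite superset makes the values of \<open>bil\<close> comparable.\<close>

lemma bil_superset:
  assumes "finite A" "{s. u s \<noteq> 0} \<subseteq> A" "finite B" "{s. v s \<noteq> 0} \<subseteq> B"
  shows "bil M u v = (\<Sum>s\<in>A. \<Sum>t\<in>B. u s * v t * bil_coeff M s t)"
proof -
  have "bil M u v = (\<Sum>s\<in>{s. u s \<noteq> 0}. \<Sum>t\<in>B. u s * v t * bil_coeff M s t)"
    unfolding bil_def using assms by (intro sum.cong refl sum.mono_neutral_left) auto
  also have "\<dots> = (\<Sum>s\<in>A. \<Sum>t\<in>B. u s * v t * bil_coeff M s t)"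
    using assms by (intro sum.mono_neutral_left) auto
  finally show ?thesis .
qed

lemma V_lincomb: "u \<in> V \<Longrightarrow> v \<in> V \<Longrightarrow> (\<lambda>x. a * u x + b * v x) \<in> V"
proof -
  assume u: "u \<in> V" and v: "v \<in> V"
  have "{s. a * u s + b * v s \<noteq> 0} \<subseteq> {s. u s \<noteq> 0} \<union> {s. v s \<noteq> 0}" by auto
  with u v show ?thesis unfolding V_def by (auto intro: finite_subset)
qed

lemma bil_sym:
  assumes "u \<in> V" "v \<in> V" shows "bil M u v = bil M v u"
proof -
  have "bil M u v = (\<Sum>t\<in>{t. v t \<noteq> 0}. \<Sum>s\<in>{s. u s \<noteq> 0}. u s * v t * bil_coeff M s t)"
    unfolding bil_def by (rule sum.swap)
  also have "\<dots> = bil M v u"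
    unfolding bil_def using assms unfolding V_def
    by (intro sum.cong refl) (auto intro!: bil_coeff_sym)
  finally show ?thesis .
qed

lemma bil_lincomb_left:
  assumes "u \<in> V" "v \<in> V" "w \<in> V"
  shows "bil M (\<lambda>x. a * u x + b * v x) w = a * bil M u w + b * bil M v w"
proof -
  let ?A = "{s. u s \<noteq> 0} \<union> {s. v s \<noteq> 0}" and ?B = "{s. w s \<noteq> 0}"
  have fin: "finite ?A" "finite ?B" using assms by (auto simp: V_def)
  have "bil M (\<lambda>x. a * u x + b * v x) w
      = (\<Sum>s\<in>?A. \<Sum>t\<in>?B. (a * u s + b * v s) * w t * bil_coeff M s t)"
    by (rule bil_superset) (use fin in auto)
  moreover have "bil M u w = (\<Sum>s\<in>?A. \<Sum>t\<in>?B. u s * w t * bil_coeff M s t)"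
    by (rule bil_superset) (use fin in auto)
  moreover have "bil M v w = (\<Sum>s\<in>?A. \<Sum>t\<in>?B. v s * w t * bil_coeff M s t)"
    by (rule bil_superset) (use fin in auto)
  ultimately show ?thesis
    by (simp add: sum_distrib_left sum.distrib algebra_simps)
qed

lemma bil_lincomb_right:
  assumes "u \<in> V" "v \<in> V" "w \<in> V"
  shows "bil M w (\<lambda>x. a * u x + b * v x) = a * bil M w u + b * bil M w v"
  using bil_lincomb_left[OF assms] by (simp add: bil_sym[of w] assms V_lincomb)

lemma alpha_V: "s \<in> S \<Longrightarrow> alpha s \<in> V"
  by (auto simp: V_def alpha_def)

lemma bil_alpha: "bil M (alpha s) (alpha t) = bil_coeff M s t"
proof -
  have "{x. alpha s x \<noteq> 0} = {s}" "{x. alpha t x \<noteq> 0} = {t}" by (auto simp: alpha_def)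
  then show ?thesis by (simp add: bil_def) (simp add: alpha_def)
qed

lemma alpha_inj: "alpha s = alpha t \<longleftrightarrow> s = t"
  by (metis alpha_def zero_neq_one)

text \<open>The factor 1 is kept so that a reflection matches the two-term pattern of the linearity
  lemmas.\<close>

lemma refl_lincomb_eq: "Defs.refl M \<beta> v = (\<lambda>x. 1 * v x + (- bil M v \<beta>) * \<beta> x)"
  by (simp add: Defs.refl_def)

lemma refl_V: "\<beta> \<in> V \<Longrightarrow> v \<in> V \<Longrightarrow> Defs.refl M \<beta> v \<in> V"
  unfolding refl_lincomb_eq by (rule V_lincomb)

lemma refl_lincomb:
  assumes "\<beta> \<in> V" "u \<in> V" "v \<in> V"
  shows "Defs.refl M \<beta> (\<lambda>x. a * u x + b * v x) = (\<lambda>x. a * Defs.refl M \<beta> u x + b * Defs.refl M \<beta> v x)"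
  using assms by (auto simp: Defs.refl_def bil_lincomb_left algebra_simps)

lemma bil_refl:
  assumes "\<beta> \<in> V" "u \<in> V" "v \<in> V" "bil M \<beta> \<beta> = 2"
  shows "bil M (Defs.refl M \<beta> u) (Defs.refl M \<beta> v) = bil M u v"
  using assms unfolding refl_lincomb_eq
  by (simp add: bil_lincomb_left bil_lincomb_right V_lincomb bil_sym[of \<beta> v] del: mult_1 mult_minus_left)
     (simp add: algebra_simps)

lemma refl_refl:
  assumes "\<beta> \<in> V" "v \<in> V" "bil M \<beta> \<beta> = 2"
  shows "Defs.refl M \<beta> (Defs.refl M \<beta> v) = v"
proof -
  have "bil M (Defs.refl M \<beta> v) \<beta> = - bil M v \<beta>"
    unfolding refl_lincomb_eq using assms by (simp only: bil_lincomb_left)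
  then show ?thesis by (simp add: Defs.refl_def)
qed

lemma bil_alpha_same: "s \<in> S \<Longrightarrow> bil M (alpha s) (alpha s) = 2"
  by (simp add: bil_alpha bil_coeff_same)

lemma act_append: "act M (u @ v) x = act M u (act M v x)"
  by (induction u) auto

lemma act_V: "w \<in> lists S \<Longrightarrow> v \<in> V \<Longrightarrow> act M w v \<in> V"
  by (induction w) (auto intro: refl_V alpha_V)

lemma act_lincomb:
  "w \<in> lists S \<Longrightarrow> u \<in> V \<Longrightarrow> v \<in> V \<Longrightarrow>
     act M w (\<lambda>x. a * u x + b * v x) = (\<lambda>x. a * act M w u x + b * act M w v x)"
  by (induction w) (auto simp: refl_lincomb alpha_V act_V)

lemma bil_act: "w \<in> lists S \<Longrightarrow> u \<in> V \<Longrightarrow> v \<in> V \<Longrightarrow> bil M (act M w u) (act M w v) = bil M u v"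
  by (induction w) (auto simp: bil_refl bil_alpha_same alpha_V act_V)

lemma act_rev_act: "w \<in> lists S \<Longrightarrow> v \<in> V \<Longrightarrow> act M (rev w) (act M w v) = v"
  by (induction w) (auto simp: act_append refl_refl bil_alpha_same alpha_V act_V)

lemma lists_rev: "w \<in> lists S \<Longrightarrow> rev w \<in> lists S"
  by (simp add: in_lists_conv_set)

lemma act_act_rev: "w \<in> lists S \<Longrightarrow> v \<in> V \<Longrightarrow> act M w (act M (rev w) v) = v"
  using act_rev_act[OF lists_rev] by simp

lemma act_inj: "w \<in> lists S \<Longrightarrow> u \<in> V \<Longrightarrow> v \<in> V \<Longrightarrow> act M w u = act M w v \<longleftrightarrow> u = v"
  by (metis act_rev_act)

text \<open>Since \<open>w\<close> is linear and preserves the form, it conjugates the reflection in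
  \<beta> into the reflection in \<open>w(\<beta>)\<close>.\<close>

lemma refl_act:
  assumes "w \<in> lists S" "\<beta> \<in> V" "v \<in> V"
  shows "Defs.refl M (act M w \<beta>) (act M w v) = act M w (Defs.refl M \<beta> v)"
  unfolding refl_lincomb_eq using assms by (simp only: bil_act act_lincomb)

lemma refl_alpha_same: "s \<in> S \<Longrightarrow> Defs.refl M (alpha s) (alpha s) = (\<lambda>x. - alpha s x)"
  by (auto simp: Defs.refl_def bil_alpha_same)

lemma act_uminus: "w \<in> lists S \<Longrightarrow> v \<in> V \<Longrightarrow> act M w (\<lambda>x. - v x) = (\<lambda>x. - act M w v x)"
  using act_lincomb[of w v v "-1" 0] by simp

lemma roots_V: "\<beta> \<in> roots S M \<Longrightarrow> \<beta> \<in> V"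
  unfolding roots_def using act_V alpha_V by blast

lemma alpha_roots: "s \<in> S \<Longrightarrow> alpha s \<in> roots S M"
  unfolding roots_def by (force intro!: exI[of _ "[]"])

lemma act_roots: "w \<in> lists S \<Longrightarrow> \<beta> \<in> roots S M \<Longrightarrow> act M w \<beta> \<in> roots S M"
proof -
  assume w: "w \<in> lists S" and "\<beta> \<in> roots S M"
  then obtain u s where "u \<in> lists S" "s \<in> S" "\<beta> = act M u (alpha s)"
    unfolding roots_def by blast
  with w show ?thesis
    unfolding roots_def by (auto simp: act_append[symmetric] intro!: exI[of _ "w @ u"])
qed

section \<open>Rank two\<close>

lemma altword_Suc_left: "altword b a (Suc n) = (if even n then a else b) # altword b a n"
  by (induction n arbitrary: a b) auto

lemma altword_add: "even n \<Longrightarrow> altword b a (k + n) = altword b a k @ altword b a n"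
  and altword_add_odd: "odd n \<Longrightarrow> altword b a (k + n) = altword a b k @ altword b a n"
  by (induction n arbitrary: a b) auto

lemma length_altword [simp]: "length (altword b a n) = n"
  by (induction n arbitrary: a b) auto

lemma map_altword: "map f (altword b a n) = altword (f b) (f a) n"
  by (induction n arbitrary: a b) auto

lemma rev_altword: "rev (altword b a n) = (if even n then altword a b n else altword b a n)"
proof (induction n arbitrary: a b)
  case (Suc n)
  then show ?case by (subst altword.simps) (simp add: altword_Suc_left del: altword.simps(2))
qed simp

lemma altword_lists: "a \<in> X \<Longrightarrow> b \<in> X \<Longrightarrow> altword b a n \<in> lists X"
  by (induction n arbitrary: a b) auto

text \<open>Chebyshev polynomials of the second kind, shifted by one: \<open>dih c n\<close> is
  U_(n-1)(c/2). They are the coordinates of the roots in a rank two subsystem.\<close>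

fun dih :: "real \<Rightarrow> nat \<Rightarrow> real" where
  "dih c 0 = 0"
| "dih c (Suc 0) = 1"
| "dih c (Suc (Suc n)) = c * dih c (Suc n) - dih c n"

text \<open>Each new letter on the left changes one coordinate only, and the change is one step of
  the recursion of \<open>dih\<close>; the parity of \<open>k\<close> tells which coordinate was
  changed last.\<close>

lemma act_altword_alpha:
  assumes "s \<in> S" "t \<in> S" "s \<noteq> t"
  defines "c \<equiv> - bil_coeff M s t"
  shows "act M (altword s t k) (alpha s) =
    (\<lambda>x. dih c (if even k then Suc k else k) * alpha s x + dih c (if even k then k else Suc k) * alpha t x)"
proof (induction k)
  case (Suc k)
  have st: "Defs.refl M (alpha t) (alpha s) = (\<lambda>x. alpha s x + c * alpha t x)"
           "Defs.refl M (alpha s) (alpha t) = (\<lambda>x. alpha t x + c * alpha s x)"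
    using assms by (auto simp: Defs.refl_def bil_alpha c_def bil_coeff_sym[of t s])
  show ?case
    unfolding altword_Suc_left using assms(1,2)
    by (cases "even k")
      (simp_all add: Suc.IH refl_lincomb alpha_V refl_alpha_same st fun_eq_iff
        del: altword.simps(2), simp_all add: algebra_simps)
qed simp

lemma dih_sin: "sin \<theta> \<noteq> 0 \<Longrightarrow> dih (2 * cos \<theta>) n = sin (real n * \<theta>) / sin \<theta>"
proof (induction "2 * cos \<theta>" n rule: dih.induct)
  case (3 n)
  have "sin (real (Suc (Suc n)) * \<theta>) + sin (real n * \<theta>) = 2 * cos \<theta> * sin (real (Suc n) * \<theta>)"
    using sin_add[of "real (Suc n) * \<theta>" \<theta>] sin_diff[of "real (Suc n) * \<theta>" \<theta>]
    by (simp add: algebra_simps)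
  with 3 show ?case by (simp add: divide_simps) (simp add: algebra_simps)
qed auto

lemma dih_two: "dih 2 n = real n"
  by (induction "2::real" n rule: dih.induct) auto

text \<open>With c = 2 cos(pi/m) the value is sin(k pi/m) / sin(pi/m), positive for 0 < k < m; for
  an infinite label c = 2 and the value is k.\<close>

lemma dih_pos:
  assumes "s \<in> S" "t \<in> S" "s \<noteq> t" "1 \<le> k" "enat k < M s t"
  shows "0 < dih (- bil_coeff M s t) k"
proof (cases "M s t")
  case (enat m)
  with assms have m: "2 \<le> m" "k < m" by (auto simp: M_enat_ge2)
  then have a: "0 < sin (pi / real m)" by (intro sin_gt_zero) (auto simp: divide_simps)
  have "0 < sin (real k * (pi / real m))" using m assms by (intro sin_gt_zero) (auto simp: divide_simps)
  with a show ?thesis by (simp add: bil_coeff_def enat dih_sin)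
next
  case infinity
  with assms show ?thesis by (simp add: bil_coeff_def dih_two)
qed

lemma dih_end:
  assumes "s \<in> S" "t \<in> S" "s \<noteq> t" "M s t = enat m"
  shows "dih (- bil_coeff M s t) m = 0" "dih (- bil_coeff M s t) (m - 1) = 1"
proof -
  from assms have m: "2 \<le> m" by (auto simp: M_enat_ge2)
  then have a: "0 < sin (pi / real m)" by (intro sin_gt_zero) (auto simp: divide_simps)
  have "real (m - 1) * (pi / real m) = pi - pi / real m" using m by (simp add: field_simps of_nat_diff)
  then have "sin (real (m - 1) * (pi / real m)) = sin (pi / real m)" by simp
  with a m show "dih (- bil_coeff M s t) m = 0" "dih (- bil_coeff M s t) (m - 1) = 1"
    by (simp_all add: bil_coeff_def assms dih_sin)
qed

text \<open>At k = m - 1 one coordinate is sin(pi) = 0 up to scaling and the other is 1. This is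
  relation (v3) read on simple roots.\<close>

lemma act_altword_end:
  assumes "s \<in> S" "t \<in> S" "s \<noteq> t" "M s t = enat m"
  shows "act M (altword s t (m - 1)) (alpha s) = alpha (if even m then s else t)"
proof -
  obtain n where m: "m = Suc n" using M_enat_ge2[OF assms] by (cases m) auto
  show ?thesis using act_altword_alpha[OF assms(1-3), of "m - 1"] dih_end[OF assms]
    by (auto simp: m)
qed

text \<open>With \<open>u = altword s t (m - 1)\<close> the two sides of the braid relation take the
  shapes \<open>u s\<close> and \<open>r u\<close>, to which \<open>act_conj\<close>
  applies.\<close>

lemma altword_swap:
  assumes "1 \<le> m"
  shows "altword t s m = altword s t (m - 1) @ [s]"
    and "altword s t m = (if even m then s else t) # altword s t (m - 1)"
proof -
  obtain n where "m = Suc n" using assms by (cases m) auto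
  then show "altword t s m = altword s t (m - 1) @ [s]"
    and "altword s t m = (if even m then s else t) # altword s t (m - 1)"
    using altword_Suc_left[of s t n] by simp_all
qed

lemma act_conj:
  assumes "u \<in> lists S" "s \<in> S" "act M u (alpha s) = alpha r" "v \<in> V"
  shows "act M (u @ [s]) v = act M (r # u) v"
  using refl_act[of u "alpha s" v] assms by (simp add: act_append alpha_V)

lemma act_braid:
  assumes "s \<in> S" "t \<in> S" "s \<noteq> t" "M s t = enat m" "v \<in> V"
  shows "act M (altword t s m) v = act M (altword s t m) v"
  using act_conj[OF altword_lists _ act_altword_end[OF assms(1-4)] assms(5)] assms M_enat_ge2[OF assms(1-4)]
    altword_swap(1)[of m t s] altword_swap(2)[of m s t] by simp

section \<open>Reduced words\<close>

text \<open>The Coxeter group as a congruence on positive words: its generators are involutions, so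
  no inverse letters are required. \<open>coxeq_W\<close> and \<open>coxeq_VA\<close> carry it over
  to the presented groups.\<close>

inductive coxeq :: "'s list \<Rightarrow> 's list \<Rightarrow> bool" (infix "\<approx>" 50) where
  ce_refl: "w \<in> lists S \<Longrightarrow> w \<approx> w"
| ce_sym: "u \<approx> v \<Longrightarrow> v \<approx> u"
| ce_trans [trans]: "u \<approx> v \<Longrightarrow> v \<approx> w \<Longrightarrow> u \<approx> w"
| ce_append: "u \<approx> v \<Longrightarrow> u' \<approx> v' \<Longrightarrow> u @ u' \<approx> v @ v'"
| ce_square: "s \<in> S \<Longrightarrow> [s, s] \<approx> []"
| ce_braid: "s \<in> S \<Longrightarrow> t \<in> S \<Longrightarrow> s \<noteq> t \<Longrightarrow> M s t = enat m \<Longrightarrow> altword t s m \<approx> altword s t m"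

lemma coxeq_lists: "u \<approx> v \<Longrightarrow> u \<in> lists S \<and> v \<in> lists S"
  by (induction rule: coxeq.induct) (simp_all add: altword_lists)

lemma coxeq_act: "u \<approx> v \<Longrightarrow> x \<in> V \<Longrightarrow> act M u x = act M v x"
proof (induction arbitrary: x rule: coxeq.induct)
  case (ce_append u v u' v')
  then show ?case using coxeq_lists[OF ce_append(2)] by (simp add: act_append act_V)
qed (auto simp: act_braid refl_refl alpha_V bil_alpha_same)

lemma coxeq_parity: "u \<approx> v \<Longrightarrow> even (length u) = even (length v)"
  by (induction rule: coxeq.induct) auto

lemma coxeq_append_left: "w \<in> lists S \<Longrightarrow> u \<approx> v \<Longrightarrow> w @ u \<approx> w @ v"
  and coxeq_append_right: "w \<in> lists S \<Longrightarrow> u \<approx> v \<Longrightarrow> u @ w \<approx> v @ w"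
  by (auto intro: ce_append ce_refl)

lemma coxeq_cancel_rev: "w \<in> lists S \<Longrightarrow> w @ rev w \<approx> []"
proof (induction w)
  case (Cons s w)
  have "[s] @ (w @ rev w) @ [s] \<approx> [s] @ [] @ [s]"
    using Cons by (intro coxeq_append_left coxeq_append_right) auto
  also have "\<dots> \<approx> []" using Cons by (auto intro: ce_square)
  finally show ?case by simp
qed (auto intro: ce_refl)

definition reduced :: "'s list \<Rightarrow> bool" where
  "reduced w \<longleftrightarrow> w \<in> lists S \<and> (\<forall>u. w \<approx> u \<longrightarrow> length w \<le> length u)"

lemma reduced_lists: "reduced w \<Longrightarrow> w \<in> lists S"
  by (simp add: reduced_def)

lemma ex_reduced:
  assumes "w \<in> lists S" obtains u where "w \<approx> u" "reduced u"
proof -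
  obtain u where u: "w \<approx> u" "\<And>v. w \<approx> v \<Longrightarrow> length u \<le> length v"
    using ex_has_least_nat[of "\<lambda>u. w \<approx> u" w length] ce_refl[OF assms] by blast
  then have "reduced u"
    unfolding reduced_def using coxeq_lists ce_trans by blast
  with u that show ?thesis by blast
qed

lemma reduced_coxeq:
  assumes "reduced w" "w \<approx> u" "length u = length w" shows "reduced u"
  using assms coxeq_lists ce_trans unfolding reduced_def by metis

lemma reduced_prefix:
  assumes "reduced (u @ v)" shows "reduced u"
proof -
  have uv: "u \<in> lists S" "v \<in> lists S" using assms by (auto simp: reduced_def)
  have "length u \<le> length u'" if "u \<approx> u'" for u'
  proof -
    have "u @ v \<approx> u' @ v" using that uv by (intro coxeq_append_right)
    with assms show ?thesis unfolding reduced_def by fastforce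
  qed
  with uv show ?thesis by (simp add: reduced_def)
qed

text \<open>By parity, appending a letter never preserves the length of an element, so it drops by
  exactly one; the shorter word followed by \<open>a\<close> is again a word for
  \<open>v\<close>.\<close>

lemma not_reduced_snocE:
  assumes "reduced v" "a \<in> S" "\<not> reduced (v @ [a])"
  obtains u where "v \<approx> u @ [a]" "length v = Suc (length u)"
proof -
  have v: "v \<in> lists S" using assms reduced_lists by blast
  then obtain u where u: "v @ [a] \<approx> u" "length u < Suc (length v)"
    using assms by (auto simp: reduced_def not_le)
  have "even (length u) \<noteq> even (length v)" using coxeq_parity[OF u(1)] by auto
  with u(2) have lt: "length u < length v" by (metis less_SucE)
  have "v @ [a, a] \<approx> u @ [a]" using coxeq_append_right[OF _ u(1), of "[a]"] assms(2) by simp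
  moreover have "v @ [a, a] \<approx> v"
    using coxeq_append_left[OF v ce_square[OF assms(2)]] by simp
  ultimately have e: "v \<approx> u @ [a]" using ce_sym ce_trans by blast
  with assms(1) have "length v \<le> Suc (length u)" by (force simp: reduced_def)
  with lt e that show ?thesis by simp
qed

lemma not_reduced_square:
  assumes "v \<approx> u @ [a]" "a \<in> S" "length v = Suc (length u)" shows "\<not> reduced (v @ [a])"
proof
  assume r: "reduced (v @ [a])"
  have u: "u \<in> lists S" using coxeq_lists[OF assms(1)] by auto
  have "v @ [a] \<approx> u @ [a, a]" using coxeq_append_right[OF _ assms(1), of "[a]"] assms(2) by simp
  also have "\<dots> \<approx> u" using coxeq_append_left[OF u ce_square[OF assms(2)]] by simp
  finally show False using r assms(3) by (fastforce simp: reduced_def)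
qed

text \<open>The decomposition of \<open>w\<close> with respect to the parabolic subgroup generated by \<open>s\<close> and \<open>t\<close>,
  with \<open>t\<close> the last letter of \<open>w\<close>: the first factor is taken as short as possible.\<close>

lemma parabolic_decomposition:
  assumes red: "reduced (w @ [s])" and "w \<noteq> []"
  obtains v t k where "t \<in> S" "s \<noteq> t" "w \<approx> v @ altword s t k" "1 \<le> k" "length v + k = length w"
    "reduced (v @ [s])" "reduced (v @ [t])" "enat k < M s t"
proof -
  obtain w1 t where w: "w = w1 @ [t]" using \<open>w \<noteq> []\<close> by (cases w rule: rev_cases) auto
  have S: "s \<in> S" "t \<in> S" "w1 \<in> lists S" "w \<in> lists S"
    using reduced_lists[OF red] w by auto
  have rw: "reduced w" using red by (rule reduced_prefix)
  \<comment> \<open>As \<open>w @ [s]\<close> is reduced, no word for \<open>w\<close> of minimal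
    length ends in \<open>s\<close>. Both \<open>s \<noteq> t\<close> and the bound on
    \<open>k\<close> come from this.\<close>
  have no_s: False if "w \<approx> u @ [s]" "length w = Suc (length u)" for u
    using not_reduced_square[OF that(1) S(1) that(2)] red by blast
  have st: "s \<noteq> t" using no_s[of w1] w ce_refl[OF S(4)] by auto
  \<comment> \<open>\<open>P k\<close> says that an alternating tail of length \<open>k\<close>
    ending in \<open>t\<close> splits off without loss of length; the greatest such \<open>k\<close>
    gives the shortest \<open>v\<close>.\<close>
  define P where "P k \<longleftrightarrow> (\<exists>v. w \<approx> v @ altword s t k \<and> length v + k = length w)" for k
  have "P 1" unfolding P_def using w S by (intro exI[of _ w1]) (auto intro: ce_refl)
  moreover have bound: "\<forall>k. P k \<longrightarrow> k \<le> length w" by (auto simp: P_def)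
  ultimately obtain k where k: "P k" "\<And>j. P j \<Longrightarrow> j \<le> k"
    using ex_has_greatest_nat[of P 1 id "Suc (length w)"] by (auto simp: less_Suc_eq_le)
  then have k1: "1 \<le> k" using \<open>P 1\<close> by blast
  obtain v where v: "w \<approx> v @ altword s t k" "length v + k = length w" using k(1) by (auto simp: P_def)
  have rva: "reduced (v @ altword s t k)" using reduced_coxeq[OF rw v(1)] v(2) by simp
  then have rv: "reduced v" by (rule reduced_prefix)
  note vS = reduced_lists[OF rv]
  \<comment> \<open>\<open>b\<close> is the first letter of the alternating tail and
    \<open>a\<close> the letter that would extend it to the left, so together they are
    \<open>s\<close> and \<open>t\<close>. Maximality of \<open>k\<close> handles \<open>a\<close>,
    and \<open>v @ [b]\<close> is a prefix of a reduced word.\<close>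
  define a b where "a = (if even k then t else s)" and "b = (if even k then s else t)"
  have ab: "a \<in> S" "b \<in> S" using S by (auto simp: a_def b_def)
  have A: "altword s t (Suc k) = a # altword s t k" by (simp add: altword_Suc_left a_def del: altword.simps)
  have B: "altword s t k = b # altword s t (k - 1)" using altword_swap(2)[OF k1, of s t] by (simp add: b_def)
  have altS: "altword s t j \<in> lists S" for j using S by (intro altword_lists)
  have "reduced (v @ [a])"
  proof (rule ccontr)
    assume "\<not> ?thesis"
    then obtain u where u: "v \<approx> u @ [a]" "length v = Suc (length u)"
      using not_reduced_snocE rv ab by blast
    have "w \<approx> u @ altword s t (Suc k)"
      using ce_trans[OF v(1) coxeq_append_right[OF altS u(1)]] by (simp add: A del: altword.simps)
    then have "P (Suc k)" unfolding P_def using u v by (intro exI[of _ u]) simp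
    then show False using k(2) by fastforce
  qed
  moreover have "reduced (v @ [b])"
    using reduced_prefix[of "v @ [b]" "altword s t (k - 1)"] rva B by simp
  ultimately have red_st: "reduced (v @ [s])" "reduced (v @ [t])"
    by (auto simp: a_def b_def split: if_splits)
  \<comment> \<open>A tail of length at least \<open>m\<close> would contain a full braid word;
    exchanging it makes the word end in \<open>s\<close>.\<close>
  have "enat k < M s t"
  proof (rule ccontr)
    assume "\<not> ?thesis"
    then obtain m where m: "M s t = enat m" "m \<le> k" by (cases "M s t") auto
    have m2: "2 \<le> m" using M_enat_ge2[OF S(1,2) st m(1)] .
    obtain x y where "altword s t (k - m + m) = altword x y (k - m) @ altword s t m" "x \<in> S" "y \<in> S"
      using altword_add[of m s t "k - m"] altword_add_odd[of m s t "k - m"] S by (cases "even m") auto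
    then have e: "altword s t k = altword x y (k - m) @ altword s t m" and xy: "altword x y (k - m) \<in> lists S"
      using m(2) altword_lists by auto
    have "altword s t m \<approx> altword s t (m - 1) @ [s]"
      using ce_sym[OF ce_braid[OF S(1,2) st m(1)]] altword_swap(1)[of m t s] m2 by simp
    then have "v @ altword s t k \<approx> (v @ altword x y (k - m) @ altword s t (m - 1)) @ [s]"
      unfolding e using vS xy by (simp add: coxeq_append_left)
    then have "w \<approx> (v @ altword x y (k - m) @ altword s t (m - 1)) @ [s]" using v(1) ce_trans by blast
    then show False by (rule no_s) (use v(2) m(2) m2 in simp)
  qed
  with S st v k1 red_st that show ?thesis by blast
qed

section \<open>Positivity of roots, faithfulness, and elements that send a simple root to a simple
  root\<close>

lemma act_decomposed:
  assumes "s \<in> S" "t \<in> S" "s \<noteq> t" "v \<in> lists S" "w \<approx> v @ altword s t k"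
  defines "c \<equiv> - bil_coeff M s t"
  shows "act M w (alpha s) = (\<lambda>x. dih c (if even k then Suc k else k) * act M v (alpha s) x
    + dih c (if even k then k else Suc k) * act M v (alpha t) x)"
proof -
  have "act M w (alpha s) = act M v (act M (altword s t k) (alpha s))"
    using coxeq_act[OF assms(5)] assms(1) by (simp add: alpha_V act_append)
  then show ?thesis using assms(1-4)
    by (simp add: act_altword_alpha act_lincomb alpha_V c_def)
qed

lemma dih_nonneg:
  assumes "s \<in> S" "t \<in> S" "s \<noteq> t" "enat k \<le> M s t"
  shows "0 \<le> dih (- bil_coeff M s t) k"
proof -
  consider "k = 0" | "M s t = enat k" | "1 \<le> k" "enat k < M s t"
    using assms(4) order_le_less[of "enat k" "M s t"] by fastforce
  then show ?thesis
    using dih_pos[OF assms(1-3), of k] dih_end(1)[OF assms(1-3), of k] by cases simp_all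
qed

text \<open>By induction on the length: the parabolic decomposition writes the root as a combination
  of \<open>v(\<alpha>_s)\<close> and \<open>v(\<alpha>_t)\<close> for a shorter \<open>v\<close>,
  with coefficients nonnegative because \<open>k\<close> is below the label.\<close>

lemma reduced_act_nonneg:
  assumes "reduced (w @ [s])" shows "0 \<le> act M w (alpha s) x"
  using assms
proof (induction "length w" arbitrary: w s x rule: less_induct)
  case less
  show ?case
  proof (cases "w = []")
    case True
    then show ?thesis by (simp add: alpha_def)
  next
    case False
    then obtain v t k where d: "t \<in> S" "s \<noteq> t" "w \<approx> v @ altword s t k" "1 \<le> k" "length v + k = length w"
      "reduced (v @ [s])" "reduced (v @ [t])" "enat k < M s t"
      using parabolic_decomposition[OF less.prems] by blast
    have s: "s \<in> S" and v: "v \<in> lists S" using reduced_lists[OF less.prems] reduced_lists[OF d(6)] by auto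
    have "0 \<le> act M v (alpha s) x" "0 \<le> act M v (alpha t) x" using less.hyps d by auto
    moreover have "0 \<le> dih (- bil_coeff M s t) k" "0 \<le> dih (- bil_coeff M s t) (Suc k)"
      using d s by (auto intro!: dih_nonneg simp: Suc_ile_eq)
    ultimately show ?thesis unfolding act_decomposed[OF s d(1,2) v d(3)] by simp
  qed
qed

text \<open>If a reduced word for \<open>w\<close> ended in \<open>s\<close>, then \<alpha>_s =
  \<open>w(\<alpha>_s)\<close> would be the negative of a nonnegative vector.\<close>

lemma act_id_coxeq_Nil:
  assumes "w \<in> lists S" "\<And>x. x \<in> V \<Longrightarrow> act M w x = x" shows "w \<approx> []"
proof -
  obtain u where u: "w \<approx> u" "reduced u" using ex_reduced[OF assms(1)] .
  have "u = []"
  proof (rule ccontr)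
    assume "u \<noteq> []"
    then obtain u' s where us: "u = u' @ [s]" by (cases u rule: rev_cases) auto
    have s: "s \<in> S" "u' \<in> lists S" using reduced_lists[OF u(2)] us by auto
    have "alpha s = act M u (alpha s)" using coxeq_act[OF u(1)] assms(2) s by (simp add: alpha_V)
    also have "\<dots> = (\<lambda>x. - act M u' (alpha s) x)"
      using s by (simp add: us act_append refl_alpha_same act_uminus alpha_V)
    finally have "alpha s s = - act M u' (alpha s) s" by metis
    with reduced_act_nonneg[of u' s s] u(2) us show False by (simp add: alpha_def)
  qed
  with u show ?thesis by simp
qed

lemma faithful:
  assumes "u \<in> lists S" "v \<in> lists S" "\<And>x. x \<in> V \<Longrightarrow> act M u x = act M v x"
  shows "u \<approx> v"
proof -
  have "rev v @ u \<approx> []"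
    using assms by (intro act_id_coxeq_Nil) (auto simp: act_append act_rev_act lists_rev)
  then have a: "v @ rev v @ u \<approx> v"
    using coxeq_append_left[OF assms(2)] by fastforce
  have b: "v @ rev v @ u \<approx> u"
    using coxeq_append_right[OF assms(1) coxeq_cancel_rev[OF assms(2)]] by simp
  show ?thesis by (rule ce_trans[OF ce_sym[OF b] a])
qed

text \<open>The image is a multiple of \<alpha>_r, and invariance of the form forces the square of
  the factor to be 1; nonnegativity excludes -1.\<close>

lemma nonneg_multiple:
  assumes "w \<in> lists S" "s \<in> S" "r \<in> S" "\<And>x. 0 \<le> act M w (alpha s) x"
    "\<And>x. x \<noteq> r \<Longrightarrow> act M w (alpha s) x = 0"
  shows "act M w (alpha s) = alpha r"
proof -
  let ?c = "act M w (alpha s) r"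
  have e: "act M w (alpha s) = (\<lambda>x. ?c * alpha r x + 0 * alpha r x)"
    using assms(5) by (auto simp: alpha_def)
  have "2 = bil M (act M w (alpha s)) (act M w (alpha s))"
    using assms by (simp add: bil_act alpha_V bil_alpha_same)
  also have "\<dots> = bil M (\<lambda>x. ?c * alpha r x + 0 * alpha r x) (\<lambda>x. ?c * alpha r x + 0 * alpha r x)"
    using e by (rule arg_cong2[OF e, rotated])
  also have "\<dots> = ?c * ?c * 2"
    using assms(3) by (simp only: bil_lincomb_left bil_lincomb_right V_lincomb alpha_V bil_alpha_same) simp
  finally have "?c\<^sup>2 = 1" by (simp add: power2_eq_square)
  then have "?c = 1" using assms(4)[of r] by (simp add: power2_eq_1_iff)
  with e show ?thesis by simp
qed

text \<open>Deodhar's description of the elements sending a simple root to a simple root, as an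
  induction principle.\<close>

lemma simple_to_simple_induct [consumes 4, case_names Nil step coxeq]:
  assumes "w \<in> lists S" "s \<in> S" "r \<in> S" "act M w (alpha s) = alpha r"
  assumes base: "\<And>s. s \<in> S \<Longrightarrow> P [] s s"
    and step: "\<And>v s t m r. \<lbrakk>s \<in> S; t \<in> S; r \<in> S; v \<in> lists S; s \<noteq> t; M s t = enat m;
      P v (if even m then s else t) r\<rbrakk> \<Longrightarrow> P (v @ altword s t (m - 1)) s r"
    and coxeq: "\<And>u w s r. \<lbrakk>w \<approx> u; s \<in> S; r \<in> S; P u s r\<rbrakk> \<Longrightarrow> P w s r"
  shows "P w s r"
proof -
  have main: "P w s r" if "reduced (w @ [s])" "r \<in> S" "act M w (alpha s) = alpha r" for w s r
    using that
  proof (induction "length w" arbitrary: w s rule: less_induct)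
    case less
    have s: "s \<in> S" using reduced_lists[OF less.prems(1)] by auto
    show ?case
    proof (cases "w = []")
      case True
      then show ?thesis using less.prems base by (simp add: alpha_inj)
    next
      case False
      then obtain v t k where d: "t \<in> S" "s \<noteq> t" "w \<approx> v @ altword s t k" "1 \<le> k" "length v + k = length w"
        "reduced (v @ [s])" "reduced (v @ [t])" "enat k < M s t"
        using parabolic_decomposition[OF less.prems(1)] by blast
      have v: "v \<in> lists S" using reduced_lists[OF d(6)] by auto
      let ?d = "dih (- bil_coeff M s t)"
      have nn: "0 \<le> act M v (alpha s) x" "0 \<le> act M v (alpha t) x" for x
        using reduced_act_nonneg d by auto
      have k: "0 < ?d k" "0 \<le> ?d (Suc k)" using d s by (auto intro!: dih_pos dih_nonneg simp: Suc_ile_eq)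
      \<comment> \<open>Below the end of the dihedral range both coefficients are positive.
        Nonnegative vectors with a positive combination equal to \<alpha>_r vanish off
        \<open>r\<close>, so \<open>v\<close> would send both \<alpha>_s and \<alpha>_t to
        \<alpha>_r.\<close>
      have M: "M s t = enat (Suc k)"
      proof (rule ccontr)
        assume "M s t \<noteq> enat (Suc k)"
        then have "enat (Suc k) < M s t" using d(8) by (cases "M s t") auto
        then have k': "0 < ?d (Suc k)" using s d by (intro dih_pos) auto
        have z: "act M v (alpha s) x = 0" "act M v (alpha t) x = 0" if "x \<noteq> r" for x
        proof -
          define A B where "A = ?d (if even k then Suc k else k)" and "B = ?d (if even k then k else Suc k)"
          have AB: "0 < A" "0 < B" using k k' by (auto simp: A_def B_def)
          have "A * act M v (alpha s) x + B * act M v (alpha t) x = 0"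
            using fun_cong[OF act_decomposed[OF s d(1,2) v d(3)], of x] less.prems(3) that
            by (simp add: alpha_def A_def B_def)
          moreover have "0 \<le> A * act M v (alpha s) x" "0 \<le> B * act M v (alpha t) x"
            using AB nn by auto
          ultimately have "A * act M v (alpha s) x = 0" "B * act M v (alpha t) x = 0" by linarith+
          then show "act M v (alpha s) x = 0" "act M v (alpha t) x = 0" using AB by auto
        qed
        have "act M v (alpha s) = alpha r" "act M v (alpha t) = alpha r"
          using nonneg_multiple[OF v] nn z s d(1) less.prems(2) by blast+
        then show False using act_inj[OF v alpha_V[OF s] alpha_V[OF d(1)]] d(2) alpha_inj by metis
      qed
      let ?r = "if even (Suc k) then s else t"
      have "act M w (alpha s) = act M v (act M (altword s t k) (alpha s))"
        using coxeq_act[OF d(3)] s by (simp add: alpha_V act_append)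
      then have "act M v (alpha ?r) = alpha r"
        using act_altword_end[OF s d(1,2) M] less.prems(3) by simp
      then have "P v ?r r"
        using less.hyps[of v ?r] d less.prems(2) by auto
      then have "P (v @ altword s t (Suc k - 1)) s r"
        by (rule step[OF s d(1) less.prems(2) v d(2) M])
      then show ?thesis using coxeq[OF d(3) s less.prems(2)] by simp
    qed
  qed
  obtain u where u: "w \<approx> u" "reduced u" using ex_reduced[OF assms(1)] .
  have ua: "act M u (alpha s) = alpha r"
    using coxeq_act[OF u(1)] assms by (simp add: alpha_V)
  \<comment> \<open>Otherwise \<open>u\<close> has a reduced word ending in \<open>s\<close> and
    sends \<alpha>_s to a vector without positive coordinates, unlike \<alpha>_r.\<close>
  have "reduced (u @ [s])"
  proof (rule ccontr)
    assume "\<not> ?thesis"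
    then obtain u' where u': "u \<approx> u' @ [s]" "length u = Suc (length u')"
      using not_reduced_snocE u assms by blast
    have "u' \<in> lists S" using coxeq_lists[OF u'(1)] by auto
    then have "alpha r = (\<lambda>x. - act M u' (alpha s) x)"
      using coxeq_act[OF u'(1)] assms(2)
      by (simp add: ua[symmetric] act_append refl_alpha_same act_uminus alpha_V)
    then have "alpha r r = - act M u' (alpha s) r" by metis
    moreover have "reduced (u' @ [s])" using reduced_coxeq[OF u(2) u'(1)] u'(2) by simp
    ultimately show False using reduced_act_nonneg[of u' s r] by (simp add: alpha_def)
  qed
  then have "P u s r" using main assms(3) ua by blast
  then show ?thesis using coxeq[OF u(1) assms(2,3)] by blast
qed

end

section \<open>Presented groups\<close>

lemma inv_word_simps [simp]:
  "inv_word [] = []" "inv_word ((b, x) # w) = inv_word w @ [(\<not> b, x)]"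
  "inv_word (u @ v) = inv_word v @ inv_word u"
  by (simp_all add: inv_word_def)

lemma inv_word_inv_word [simp]: "inv_word (inv_word w) = w"
  by (induction w) auto

lemma inv_word_lists: "w \<in> lists (UNIV \<times> X) \<Longrightarrow> inv_word w \<in> lists (UNIV \<times> X)"
  by (induction w) auto

lemma word_subst_simps [simp]:
  "word_subst f [] = []"
  "word_subst f ((b, x) # w) = (if b then f x else inv_word (f x)) @ word_subst f w"
  "word_subst f (u @ v) = word_subst f u @ word_subst f v"
  by (simp_all add: word_subst_def)

lemma word_subst_lists:
  "(\<And>x. x \<in> X \<Longrightarrow> f x \<in> lists (UNIV \<times> Y)) \<Longrightarrow> w \<in> lists (UNIV \<times> X) \<Longrightarrow>
    word_subst f w \<in> lists (UNIV \<times> Y)"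
  by (induction w) (auto simp: inv_word_lists)

lemma pos_simps [simp]:
  "pos [] = []" "pos (x # xs) = (True, x) # pos xs" "pos (xs @ ys) = pos xs @ pos ys"
  by (simp_all add: pos_def)

lemma pos_lists: "xs \<in> lists X \<Longrightarrow> pos xs \<in> lists (UNIV \<times> X)"
  by (induction xs) auto

locale presentation =
  fixes X :: "'g set" and R :: "('g word \<times> 'g word) set"
  assumes rels_lists: "(u, v) \<in> R \<Longrightarrow> u \<in> lists (UNIV \<times> X) \<and> v \<in> lists (UNIV \<times> X)"
begin

definition eqv :: "'g word \<Rightarrow> 'g word \<Rightarrow> bool" (infix "\<simeq>" 50) where
  "u \<simeq> v \<longleftrightarrow> (u, v) \<in> pres_rel X R"

abbreviation "L \<equiv> lists ((UNIV :: bool set) \<times> X)"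

lemma eqv_lists: "u \<simeq> v \<Longrightarrow> u \<in> L \<and> v \<in> L"
  unfolding eqv_def
  by (induction rule: pres_rel.induct) (auto dest: rels_lists)

lemma eqv_refl: "u \<in> L \<Longrightarrow> u \<simeq> u"
  and eqv_sym: "u \<simeq> v \<Longrightarrow> v \<simeq> u"
  and eqv_trans [trans]: "u \<simeq> v \<Longrightarrow> v \<simeq> w \<Longrightarrow> u \<simeq> w"
  and eqv_rel: "(u, v) \<in> R \<Longrightarrow> u \<simeq> v"
  and eqv_append: "u \<simeq> v \<Longrightarrow> u' \<simeq> v' \<Longrightarrow> u @ u' \<simeq> v @ v'"
  and eqv_cancel: "x \<in> X \<Longrightarrow> [(b, x), (\<not> b, x)] \<simeq> []"
  unfolding eqv_def by (auto intro: pres_rel.intros)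

lemma eqv_context: "a \<in> L \<Longrightarrow> b \<in> L \<Longrightarrow> u \<simeq> v \<Longrightarrow> a @ u @ b \<simeq> a @ v @ b"
  by (intro eqv_append eqv_refl)

lemma eqv_left: "a \<in> L \<Longrightarrow> u \<simeq> v \<Longrightarrow> a @ u \<simeq> a @ v"
  and eqv_right: "a \<in> L \<Longrightarrow> u \<simeq> v \<Longrightarrow> u @ a \<simeq> v @ a"
  by (auto intro: eqv_append eqv_refl)

lemma eqv_inv_right: "u \<in> L \<Longrightarrow> u @ inv_word u \<simeq> []"
proof (induction u)
  case (Cons z u)
  obtain b x where z: "z = (b, x)" by (cases z)
  have "[(b, x)] @ (u @ inv_word u) @ [(\<not> b, x)] \<simeq> [(b, x)] @ [] @ [(\<not> b, x)]"
    using Cons by (intro eqv_context) (auto simp: z)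
  also have "\<dots> \<simeq> []" using eqv_cancel[of x b] Cons by (auto simp: z)
  finally show ?case by (simp add: z)
qed (auto intro: eqv_refl)

lemma eqv_inv_left: "u \<in> L \<Longrightarrow> inv_word u @ u \<simeq> []"
  using eqv_inv_right[of "inv_word u"] by (simp add: inv_word_lists)

lemma eqv_cancel_left:
  assumes "a \<in> L" "u \<in> L" "v \<in> L" "a @ u \<simeq> a @ v" shows "u \<simeq> v"
proof -
  have *: "inv_word a @ a @ w \<simeq> w" if "w \<in> L" for w
    using eqv_right[OF that eqv_inv_left[OF assms(1)]] by simp
  have "inv_word a @ a @ u \<simeq> inv_word a @ a @ v"
    by (rule eqv_left[OF inv_word_lists[OF assms(1)] assms(4)])
  from eqv_trans[OF eqv_sym[OF *[OF assms(2)]] eqv_trans[OF this *[OF assms(3)]]] show ?thesis .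
qed

lemma eqv_cancel_right:
  assumes "a \<in> L" "u \<in> L" "v \<in> L" "u @ a \<simeq> v @ a" shows "u \<simeq> v"
proof -
  have *: "w @ a @ inv_word a \<simeq> w" if "w \<in> L" for w
    using eqv_left[OF that eqv_inv_right[OF assms(1)]] by simp
  have "u @ a @ inv_word a \<simeq> v @ a @ inv_word a"
    using eqv_right[OF inv_word_lists[OF assms(1)] assms(4)] by simp
  from eqv_trans[OF eqv_sym[OF *[OF assms(2)]] eqv_trans[OF this *[OF assms(3)]]] show ?thesis .
qed

lemma eqv_inv:
  assumes "u \<simeq> v" shows "inv_word u \<simeq> inv_word v"
proof -
  have L: "u \<in> L" "v \<in> L" using eqv_lists[OF assms] by auto
  note Li = L[THEN inv_word_lists]
  have "u @ inv_word u \<simeq> []" by (rule eqv_inv_right[OF L(1)])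
  also have "[] \<simeq> v @ inv_word v" by (rule eqv_sym[OF eqv_inv_right[OF L(2)]])
  also have "v @ inv_word v \<simeq> u @ inv_word v" using eqv_right[OF Li(2) eqv_sym[OF assms]] .
  finally show ?thesis by (rule eqv_cancel_left[OF L(1) Li])
qed

text \<open>Extends intertwining relations from generators to the inverse letters met in
  \<open>Zs_equivariant\<close>.\<close>

lemma eqv_intertwine_inv:
  assumes "a \<in> L" "x \<in> L" "y \<in> L" "a @ x \<simeq> y @ a"
  shows "a @ inv_word x \<simeq> inv_word y @ a"
proof -
  note L = assms(1-3) assms(2,3)[THEN inv_word_lists]
  have "y @ a @ inv_word x \<simeq> a @ x @ inv_word x"
    using eqv_right[OF L(4) eqv_sym[OF assms(4)]] by simp
  also have "\<dots> \<simeq> a" using eqv_left[OF L(1) eqv_inv_right[OF L(2)]] by simp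
  also have "a \<simeq> y @ inv_word y @ a" using eqv_sym[OF eqv_right[OF L(1) eqv_inv_right[OF L(3)]]] by simp
  finally show ?thesis using L by (auto intro: eqv_cancel_left[OF L(3)])
qed

definition cls :: "'g word \<Rightarrow> 'g word set" where
  "cls u = pres_rel X R `` {u}"

lemma mem_cls: "v \<in> cls u \<longleftrightarrow> u \<simeq> v"
  by (simp add: cls_def eqv_def)

lemma cls_eq: "u \<in> L \<Longrightarrow> cls u = cls v \<longleftrightarrow> u \<simeq> v"
  by (auto simp: set_eq_iff mem_cls intro: eqv_trans eqv_sym dest: eqv_refl)

lemma some_cls: "u \<in> L \<Longrightarrow> u \<simeq> (SOME a. a \<in> cls u)"
  using someI[of "\<lambda>a. a \<in> cls u" u] by (simp add: mem_cls eqv_refl)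

lemma carrier_presented: "carrier (presented_group X R) = cls ` L"
  by (auto simp: presented_group_def quotient_def cls_def)

lemma one_presented: "one (presented_group X R) = cls []"
  by (simp add: presented_group_def cls_def)

text \<open>The product is defined through chosen representatives; since the relation is a
  congruence, any representatives give the same class. \<open>induced_map_cls\<close> does the same
  for induced maps.\<close>

lemma mult_presented:
  assumes "u \<in> L" "v \<in> L" shows "mult (presented_group X R) (cls u) (cls v) = cls (u @ v)"
proof -
  have "u @ v \<simeq> (SOME a. a \<in> cls u) @ (SOME a. a \<in> cls v)"
    using assms by (intro eqv_append some_cls)
  then show ?thesis using assms
    by (simp add: presented_group_def cls_def[symmetric] cls_eq[symmetric])
qed

end

lemma induced_map_cls:
  assumes "presentation X R" "presentation Y Q" "u \<in> lists (UNIV \<times> X)"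
    and "\<And>u v. presentation.eqv X R u v \<Longrightarrow> presentation.eqv Y Q (word_subst f u) (word_subst f v)"
  shows "induced_map Y Q f (presentation.cls X R u) = presentation.cls Y Q (word_subst f u)"
proof -
  interpret X: presentation X R by fact
  interpret Y: presentation Y Q by fact
  have "Y.eqv (word_subst f u) (word_subst f (SOME a. a \<in> X.cls u))"
    by (intro assms(4) X.some_cls assms(3))
  then show ?thesis
    using Y.cls_eq Y.eqv_lists unfolding induced_map_def Y.cls_def[symmetric] by blast
qed

text \<open>Von Dyck's theorem: a substitution respects the presentation as soon as it respects the
  defining relations.\<close>

lemma word_subst_eqv:
  assumes "presentation X R" "presentation Y Q"
    and f: "\<And>x. x \<in> X \<Longrightarrow> f x \<in> lists (UNIV \<times> Y)"
    and rels: "\<And>u v. (u, v) \<in> R \<Longrightarrow> presentation.eqv Y Q (word_subst f u) (word_subst f v)"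
    and "presentation.eqv X R u v"
  shows "presentation.eqv Y Q (word_subst f u) (word_subst f v)"
proof -
  interpret X: presentation X R by fact
  interpret Y: presentation Y Q by fact
  show ?thesis using assms(5) unfolding X.eqv_def
  proof (induction rule: pres_rel.induct)
    case (pr_refl w)
    then show ?case using f by (intro Y.eqv_refl word_subst_lists)
  next
    case (pr_cancel x b)
    then show ?case using Y.eqv_inv_right[OF f] Y.eqv_inv_left[OF f] by simp
  next
    case (pr_rel u v)
    then show ?case by (rule rels)
  qed (auto intro: Y.eqv_sym Y.eqv_trans Y.eqv_append)
qed

context coxeter
begin

section \<open>The virtual Artin group\<close>

lemma W_presentation: "presentation S (W_rels S M)"
proof
  fix u v assume "(u, v) \<in> W_rels S M"
  then show "u \<in> lists (UNIV \<times> S) \<and> v \<in> lists (UNIV \<times> S)"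
    unfolding W_rels_def by (auto intro!: pos_lists altword_lists)
qed

lemma VA_presentation: "presentation (Inl ` S \<union> Inr ` S) (VA_rels S M)"
proof
  fix u v assume "(u, v) \<in> VA_rels S M"
  then show "u \<in> lists (UNIV \<times> (Inl ` S \<union> Inr ` S)) \<and> v \<in> lists (UNIV \<times> (Inl ` S \<union> Inr ` S))"
    unfolding VA_rels_def by (auto intro!: pos_lists altword_lists)
qed

lemma refl_roots:
  assumes "\<beta> \<in> roots S M" "\<gamma> \<in> roots S M" shows "Defs.refl M \<beta> \<gamma> \<in> roots S M"
proof -
  obtain w s where w: "w \<in> lists S" "s \<in> S" "\<beta> = act M w (alpha s)"
    using assms(1) unfolding roots_def by blast
  have "Defs.refl M \<beta> \<gamma> = act M w (Defs.refl M (alpha s) (act M (rev w) \<gamma>))"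
    using refl_act[OF w(1) alpha_V[OF w(2)], of "act M (rev w) \<gamma>"] w assms(2)
    by (simp add: act_act_rev roots_V act_V lists_rev)
  also have "\<dots> = act M (w @ [s] @ rev w) \<gamma>" by (simp add: act_append)
  also have "\<dots> \<in> roots S M" using w assms(2) by (intro act_roots) (auto simp: lists_rev)
  finally show ?thesis .
qed

lemma altR_roots:
  "\<beta> \<in> roots S M \<Longrightarrow> \<gamma> \<in> roots S M \<Longrightarrow> x \<in> roots S M \<Longrightarrow>
    altR (Defs.refl M \<beta>) (Defs.refl M \<gamma>) k x \<in> roots S M"
  by (induction k arbitrary: \<beta> \<gamma> x) (auto intro: refl_roots)

lemma root_seq_roots: "\<beta> \<in> roots S M \<Longrightarrow> \<gamma> \<in> roots S M \<Longrightarrow> root_seq M \<beta> \<gamma> k \<in> roots S M"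
  by (simp add: root_seq_def altR_roots)

lemma Zword_lists:
  "\<beta> \<in> roots S M \<Longrightarrow> \<gamma> \<in> roots S M \<Longrightarrow> Zword M \<gamma> \<beta> m \<in> lists (UNIV \<times> roots S M)"
  unfolding Zword_def by (intro pos_lists) (auto simp: in_lists_conv_set root_seq_roots)

lemma PVAhat_presentation: "presentation (roots S M) (PVAhat_rels S M)"
  by standard (auto simp: PVAhat_rels_def Zword_lists)

sublocale W: presentation S "W_rels S M" by (rule W_presentation)
sublocale VA: presentation "Inl ` S \<union> Inr ` S" "VA_rels S M" by (rule VA_presentation)
sublocale Hat: presentation "roots S M" "PVAhat_rels S M" by (rule PVAhat_presentation)

abbreviation VA_eqv (infix "\<sim>" 50) where "u \<sim> v \<equiv> VA.eqv u v"

abbreviation T :: "'s list \<Rightarrow> ('s + 's) word" where "T w \<equiv> pos (map Inr w)"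

abbreviation \<xi> :: "'s \<Rightarrow> ('s + 's) word" where "\<xi> s \<equiv> pos [Inr s, Inl s]"

lemma T_lists: "w \<in> lists S \<Longrightarrow> T w \<in> VA.L"
  by (induction w) auto

lemma coxeq_W: "u \<approx> v \<Longrightarrow> W.eqv (pos u) (pos v)"
proof (induction rule: coxeq.induct)
  case (ce_refl w)
  then show ?case by (intro W.eqv_refl pos_lists)
next
  case (ce_append u v u' v')
  then show ?case by (simp add: W.eqv_append)
next
  case (ce_square s)
  then show ?case by (intro W.eqv_rel) (auto simp: W_rels_def)
next
  case (ce_braid s t m)
  then show ?case by (intro W.eqv_rel) (auto simp: W_rels_def)
qed (auto intro: W.eqv_sym W.eqv_trans)

lemma VA_relsI:
  assumes "s \<in> S" "t \<in> S" "s \<noteq> t" "M s t = enat m"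
  shows "(pos (altword (Inl t) (Inl s) m), pos (altword (Inl s) (Inl t) m)) \<in> VA_rels S M"
    and "(T (altword t s m), T (altword s t m)) \<in> VA_rels S M"
    and "(T (altword s t (m - 1)) @ pos [Inl s], pos [Inl (if even m then s else t)] @ T (altword s t (m - 1)))
      \<in> VA_rels S M"
proof -
  show "(pos (altword (Inl t) (Inl s) m), pos (altword (Inl s) (Inl t) m)) \<in> VA_rels S M"
    unfolding VA_rels_def using assms by blast
  show "(T (altword t s m), T (altword s t m)) \<in> VA_rels S M"
    unfolding VA_rels_def map_altword using assms by blast
  show "(T (altword s t (m - 1)) @ pos [Inl s], pos [Inl (if even m then s else t)] @ T (altword s t (m - 1)))
      \<in> VA_rels S M"
    unfolding VA_rels_def map_altword pos_simps(3)[symmetric] using assms by blast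
qed

lemma coxeq_VA: "u \<approx> v \<Longrightarrow> T u \<sim> T v"
proof (induction rule: coxeq.induct)
  case (ce_refl w)
  then show ?case by (intro VA.eqv_refl T_lists)
next
  case (ce_append u v u' v')
  then show ?case by (simp add: VA.eqv_append)
next
  case (ce_square s)
  then show ?case by (intro VA.eqv_rel) (auto simp: VA_rels_def)
next
  case (ce_braid s t m)
  then show ?case by (intro VA.eqv_rel VA_relsI)
qed (auto intro: VA.eqv_sym VA.eqv_trans)

lemma inv_T:
  assumes "w \<in> lists S" shows "inv_word (T w) \<sim> T (rev w)"
proof -
  have "T w @ inv_word (T w) \<sim> []" using assms by (intro VA.eqv_inv_right T_lists)
  also have "[] \<sim> T w @ T (rev w)" using VA.eqv_sym[OF coxeq_VA[OF coxeq_cancel_rev[OF assms]]] by simp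
  finally show ?thesis
    by (rule VA.eqv_cancel_left[OF T_lists[OF assms] inv_word_lists[OF T_lists[OF assms]]
          T_lists[OF lists_rev[OF assms]]])
qed

text \<open>By the induction principle the claim reduces to longest-but-one alternating words in two
  letters, where it is relation (v3).\<close>

lemma sigma_intertwine:
  assumes "w \<in> lists S" "s \<in> S" "r \<in> S" "act M w (alpha s) = alpha r"
  shows "T w @ pos [Inl s] \<sim> pos [Inl r] @ T w"
  using assms
proof (induction rule: simple_to_simple_induct)
  case (Nil s)
  then show ?case by (auto intro: VA.eqv_refl)
next
  case (step v s t m r)
  let ?A = "altword s t (m - 1)" and ?q = "if even m then s else t"
  have A: "?A \<in> lists S" and q: "?q \<in> S" using step by (auto intro: altword_lists)
  have "T ?A @ pos [Inl s] \<sim> pos [Inl ?q] @ T ?A"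
    using step by (intro VA.eqv_rel VA_relsI)
  then have "T v @ T ?A @ pos [Inl s] \<sim> T v @ pos [Inl ?q] @ T ?A"
    using VA.eqv_left[OF T_lists[OF step(4)]] by blast
  also have "T v @ pos [Inl ?q] @ T ?A \<sim> pos [Inl r] @ T v @ T ?A"
    using VA.eqv_right[OF T_lists[OF A] step(7)] by simp
  finally show ?case by simp
next
  case (coxeq u w s r)
  have L: "pos [Inl s] \<in> VA.L" "pos [Inl r] \<in> VA.L" using coxeq by auto
  have e: "T w \<sim> T u" by (rule coxeq_VA[OF coxeq(1)])
  from VA.eqv_trans[OF VA.eqv_right[OF L(1) e]
      VA.eqv_trans[OF coxeq(4) VA.eqv_left[OF L(2) VA.eqv_sym[OF e]]]]
  show ?case .
qed

text \<open>The reflections in \<alpha>_s and \<alpha>_r are conjugate under \<open>w\<close>, so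
  \<open>w s = r w\<close> holds in W by faithfulness; this moves the \<tau> letter, and
  \<open>sigma_intertwine\<close> moves the \<sigma> letter.\<close>

lemma xi_intertwine:
  assumes "w \<in> lists S" "s \<in> S" "r \<in> S" "act M w (alpha s) = alpha r"
  shows "T w @ \<xi> s \<sim> \<xi> r @ T w"
proof -
  have L: "pos [Inl s] \<in> VA.L" "pos [Inr r] \<in> VA.L" using assms by auto
  have "w @ [s] \<approx> r # w" using assms act_conj by (intro faithful) auto
  from VA.eqv_right[OF L(1) coxeq_VA[OF this]]
  have "T w @ \<xi> s \<sim> pos [Inr r] @ T w @ pos [Inl s]" by simp
  also have "\<dots> \<sim> pos [Inr r] @ pos [Inl r] @ T w"
    by (rule VA.eqv_left[OF L(2) sigma_intertwine[OF assms]])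
  finally show ?thesis by simp
qed

section \<open>The elements \<zeta>_\<beta> and the action of W on words over the roots\<close>

abbreviation "zt \<equiv> zeta_word S M"

lemma zeta_word_choice:
  assumes "\<beta> \<in> roots S M"
  obtains w s where "w \<in> lists S" "s \<in> S" "act M w (alpha s) = \<beta>"
    "zt \<beta> = T w @ \<xi> s @ inv_word (T w)"
proof -
  define p where "p = (SOME (w, s). w \<in> lists S \<and> s \<in> S \<and> act M w (alpha s) = \<beta>)"
  obtain w s where p: "p = (w, s)" by (cases p)
  have "\<exists>p. case p of (w, s) \<Rightarrow> w \<in> lists S \<and> s \<in> S \<and> act M w (alpha s) = \<beta>"
    using assms by (auto simp: roots_def)
  from someI_ex[OF this] have "w \<in> lists S \<and> s \<in> S \<and> act M w (alpha s) = \<beta>"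
    unfolding p_def[symmetric] p by simp
  moreover have "zt \<beta> = T w @ \<xi> s @ inv_word (T w)"
    unfolding zeta_word_def p_def[symmetric] p by simp
  ultimately show ?thesis using that by blast
qed

lemma zeta_word_lists: "\<beta> \<in> roots S M \<Longrightarrow> zt \<beta> \<in> VA.L"
  by (erule zeta_word_choice) (auto intro!: inv_word_lists T_lists)

text \<open>Independence of the choice of \<open>w\<close> and \<open>s\<close>. If
  \<open>u(\<alpha>_r) = w(\<alpha>_s)\<close> is the choice made in \<open>zt\<close>, then the
  inverse of \<open>u\<close> times \<open>w\<close> sends \<alpha>_s to \<alpha>_r, and
  \<open>xi_intertwine\<close> applies to it.\<close>

lemma zeta_word_T:
  assumes "w \<in> lists S" "s \<in> S"
  shows "zt (act M w (alpha s)) @ T w \<sim> T w @ \<xi> s"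
proof -
  have "act M w (alpha s) \<in> roots S M" using assms by (intro act_roots alpha_roots)
  then obtain u r where u: "u \<in> lists S" "r \<in> S" "act M u (alpha r) = act M w (alpha s)"
    and z: "zt (act M w (alpha s)) = T u @ \<xi> r @ inv_word (T u)"
    using zeta_word_choice by blast
  have uw: "rev u @ w \<in> lists S" using u assms by (simp add: lists_rev)
  have L: "T u \<in> VA.L" "T w \<in> VA.L" "\<xi> r \<in> VA.L" "\<xi> s \<in> VA.L"
    using u assms by (auto intro: T_lists)
  have "act M (rev u @ w) (alpha s) = alpha r"
    using u act_rev_act[OF u(1) alpha_V[OF u(2)]] by (simp add: act_append)
  then have i: "T (rev u @ w) @ \<xi> s \<sim> \<xi> r @ T (rev u @ w)"
    using uw u assms by (intro xi_intertwine)
  have "zt (act M w (alpha s)) @ T w = (T u @ \<xi> r) @ inv_word (T u) @ T w" by (simp add: z)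
  also have "\<dots> \<sim> (T u @ \<xi> r) @ T (rev u) @ T w"
    using L by (intro VA.eqv_context inv_T u) auto
  also have "(T u @ \<xi> r) @ T (rev u) @ T w = T u @ \<xi> r @ T (rev u @ w)" by simp
  also have "T u @ \<xi> r @ T (rev u @ w) \<sim> T u @ T (rev u @ w) @ \<xi> s"
    by (rule VA.eqv_left[OF L(1) VA.eqv_sym[OF i]])
  also have "T u @ T (rev u @ w) @ \<xi> s = T (u @ rev u) @ T w @ \<xi> s" by simp
  also have "\<dots> \<sim> [] @ T w @ \<xi> s"
    using L coxeq_VA[OF coxeq_cancel_rev[OF u(1)]] by (intro VA.eqv_right) auto
  finally show ?thesis by simp
qed

text \<open>For \<beta> = \<open>w(\<alpha>_s)\<close>, both sides followed by \<open>T w\<close>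
  become \<open>T (u @ w) @ \<xi> s\<close> by \<open>zeta_word_T\<close>.\<close>

lemma zeta_word_equivariant:
  assumes "u \<in> lists S" "\<beta> \<in> roots S M"
  shows "T u @ zt \<beta> \<sim> zt (act M u \<beta>) @ T u"
proof -
  obtain w s where w: "w \<in> lists S" "s \<in> S" "\<beta> = act M w (alpha s)"
    using assms(2) unfolding roots_def by blast
  have L: "T u \<in> VA.L" "T w \<in> VA.L" "zt \<beta> \<in> VA.L" "zt (act M u \<beta>) \<in> VA.L"
    using assms w(1) by (auto intro: T_lists zeta_word_lists act_roots)
  have "T u @ zt \<beta> @ T w \<sim> T u @ T w @ \<xi> s"
    unfolding w(3) by (rule VA.eqv_left[OF L(1) zeta_word_T[OF w(1,2)]])
  also have "T u @ T w @ \<xi> s \<sim> zt (act M u \<beta>) @ T u @ T w"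
    using VA.eqv_sym[OF zeta_word_T[of "u @ w" s]] assms(1) w by (simp add: act_append)
  finally have "(T u @ zt \<beta>) @ T w \<sim> (zt (act M u \<beta>) @ T u) @ T w" by simp
  then show ?thesis by (rule VA.eqv_cancel_right[rotated 3]) (use L in auto)
qed

definition wmap :: "'s list \<Rightarrow> ('s \<Rightarrow> real) word \<Rightarrow> ('s \<Rightarrow> real) word" where
  "wmap w u = map (\<lambda>(b, \<beta>). (b, act M w \<beta>)) u"

lemma wmap_simps [simp]:
  "wmap w [] = []" "wmap w ((b, \<beta>) # u) = (b, act M w \<beta>) # wmap w u"
  "wmap w (u @ v) = wmap w u @ wmap w v" "wmap w (wmap w' u) = wmap (w @ w') u"
  by (auto simp: wmap_def act_append)

lemma wmap_lists: "w \<in> lists S \<Longrightarrow> u \<in> Hat.L \<Longrightarrow> wmap w u \<in> Hat.L"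
  by (induction u) (auto simp: act_roots)

lemma wmap_cong:
  "(\<And>x. x \<in> V \<Longrightarrow> act M w x = act M w' x) \<Longrightarrow> u \<in> Hat.L \<Longrightarrow> wmap w u = wmap w' u"
  by (induction u) (auto simp: roots_V)

abbreviation Zs :: "('s \<Rightarrow> real) word \<Rightarrow> ('s + 's) word" where
  "Zs u \<equiv> word_subst zt u"

lemma Zs_lists: "u \<in> Hat.L \<Longrightarrow> Zs u \<in> VA.L"
  by (rule word_subst_lists[OF zeta_word_lists])

lemma Zs_equivariant:
  assumes "w \<in> lists S" "u \<in> Hat.L"
  shows "T w @ Zs u \<sim> Zs (wmap w u) @ T w"
  using assms(2)
proof (induction u rule: list.induct)
  case Nil
  then show ?case using assms(1) by (auto intro: VA.eqv_refl T_lists)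
next
  case (Cons z u)
  obtain b \<beta> where z: "z = (b, \<beta>)" by (cases z)
  have \<beta>: "\<beta> \<in> roots S M" and u: "u \<in> Hat.L" using Cons.prems by (auto simp: z)
  let ?f = "\<lambda>\<beta>. if b then zt \<beta> else inv_word (zt \<beta>)"
  have L: "T w \<in> VA.L" "zt \<beta> \<in> VA.L" "zt (act M w \<beta>) \<in> VA.L"
    using assms(1) \<beta> by (auto intro: T_lists zeta_word_lists act_roots)
  have fL: "?f (act M w \<beta>) \<in> VA.L" using L by (auto intro: inv_word_lists)
  have "T w @ ?f \<beta> \<sim> ?f (act M w \<beta>) @ T w"
    using zeta_word_equivariant[OF assms(1) \<beta>] VA.eqv_intertwine_inv[OF L] by simp
  from VA.eqv_right[OF Zs_lists[OF u] this]
  have "T w @ Zs (z # u) \<sim> ?f (act M w \<beta>) @ T w @ Zs u" by (simp add: z)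
  also have "\<dots> \<sim> ?f (act M w \<beta>) @ Zs (wmap w u) @ T w"
    by (rule VA.eqv_left[OF fL Cons.IH[OF u]])
  finally show ?case by (simp add: z)
qed

section \<open>The cocycle\<close>

text \<open>\<open>wd g\<close> is a word for the image of \<open>g\<close> in the Coxeter group, and \<open>hat g\<close> is the
  remaining factor in the normal form of \<open>g\<close>. The letter for the inverse of \<open>\<sigma>\<^sub>s\<close> carries the
  root \<open>-\<alpha>\<^sub>s = s(\<alpha>\<^sub>s)\<close> because \<open>\<sigma>\<^sub>s\<^sup>-\<^sup>1 = \<zeta>\<^sub>s\<^sup>-\<^sup>1 \<tau>\<^sub>s\<close> has to be rewritten with \<open>\<tau>\<^sub>s\<close> in front.\<close>

definition wd :: "('s + 's) word \<Rightarrow> 's list" where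
  "wd g = map (\<lambda>(b, x). case x of Inl s \<Rightarrow> s | Inr s \<Rightarrow> s) g"

lemma wd_simps [simp]:
  "wd [] = []" "wd ((b, Inl s) # g) = s # wd g" "wd ((b, Inr s) # g) = s # wd g"
  "wd (g @ h) = wd g @ wd h"
  by (simp_all add: wd_def)

lemma wd_inv_word [simp]: "wd (inv_word g) = rev (wd g)"
  by (induction g) (auto simp: wd_def)

lemma wd_T [simp]: "wd (T w) = w"
  by (induction w) auto

lemma wd_lists: "g \<in> VA.L \<Longrightarrow> wd g \<in> lists S"
  by (induction g) (auto simp: wd_def)

fun hat :: "('s + 's) word \<Rightarrow> ('s \<Rightarrow> real) word" where
  "hat [] = []"
| "hat ((b, Inl s) # g) =
    (b, act M (rev (wd g)) (if b then alpha s else act M [s] (alpha s))) # hat g"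
| "hat ((b, Inr s) # g) = hat g"

text \<open>The cocycle identity: in the product of two normal forms, moving \<open>T (wd h)\<close>
  to the front past the roots of \<open>g\<close> applies the inverse of \<open>wd h\<close> to
  them.\<close>

lemma hat_append: "hat (g @ h) = wmap (rev (wd h)) (hat g) @ hat h"
  by (induction g rule: hat.induct) (auto simp: act_append)

lemma hat_lists: "g \<in> VA.L \<Longrightarrow> hat g \<in> Hat.L"
proof (induction g rule: hat.induct)
  case (2 b s g)
  then have "act M (rev (wd g)) (if b then alpha s else act M [s] (alpha s)) \<in> roots S M"
    by (auto intro!: act_roots alpha_roots refl_roots lists_rev wd_lists)
  with 2 show ?case by auto
qed auto

lemma hat_T [simp]: "hat (T w) = []"
  by (induction w) auto

lemma hat_inv_T [simp]: "hat (inv_word (T w)) = []"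
  by (induction w) (auto simp: hat_append)

lemma sigma_eqv:
  assumes "s \<in> S"
  shows "[(True, Inl s)] \<sim> T [s] @ zt (alpha s)"
    and "[(False, Inl s)] \<sim> T [s] @ inv_word (zt (act M [s] (alpha s)))"
proof -
  have L: "T [s] \<in> VA.L" "\<xi> s \<in> VA.L" "[(True, Inl s)] \<in> VA.L" "[(False, Inl s)] \<in> VA.L"
    "zt (act M [s] (alpha s)) \<in> VA.L"
    using assms by (auto intro: zeta_word_lists refl_roots alpha_roots)
  have ss: "T [s, s] \<sim> []" using coxeq_VA[OF ce_square[OF assms]] by simp
  have z: "zt (alpha s) \<sim> \<xi> s" using zeta_word_T[of "[]" s] assms by simp
  \<comment> \<open>Insert \<tau>_s \<tau>_s = 1 and read \<tau>_s \<sigma>_s as \<zeta> of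
    \<alpha>_s.\<close>
  have "[] @ [(True, Inl s)] \<sim> T [s, s] @ [(True, Inl s)]"
    by (rule VA.eqv_right[OF L(3) VA.eqv_sym[OF ss]])
  also have "T [s, s] @ [(True, Inl s)] \<sim> T [s] @ zt (alpha s)"
    using VA.eqv_left[OF L(1) VA.eqv_sym[OF z]] by simp
  finally show "[(True, Inl s)] \<sim> T [s] @ zt (alpha s)" by simp
  \<comment> \<open>The root -\<alpha>_s gives \<sigma>_s with \<tau>_s on the right, so that
    inverting puts \<tau>_s in front.\<close>
  have "zt (act M [s] (alpha s)) @ T [s] \<sim> T [s] @ \<xi> s" using assms by (intro zeta_word_T) auto
  also have "T [s] @ \<xi> s \<sim> [(True, Inl s)]" using VA.eqv_right[OF L(3) ss] by simp
  finally have "inv_word (zt (act M [s] (alpha s)) @ T [s]) \<sim> inv_word [(True, Inl s)]"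
    by (rule VA.eqv_inv)
  then have 1: "[(False, Inr s)] @ inv_word (zt (act M [s] (alpha s))) \<sim> [(False, Inl s)]" by simp
  have "[(False, Inr s)] \<sim> T [s]" using inv_T[of "[s]"] assms by simp
  from VA.eqv_trans[OF VA.eqv_sym[OF 1] VA.eqv_right[OF inv_word_lists[OF L(5)] this]]
  show "[(False, Inl s)] \<sim> T [s] @ inv_word (zt (act M [s] (alpha s)))" .
qed

text \<open>A new letter on the left contributes \<tau>_s and at most one \<zeta> letter; the latter
  is carried past \<open>T (wd g)\<close>, which replaces its root by the one recorded in
  \<open>hat\<close>.\<close>

lemma normal_form:
  assumes "g \<in> VA.L" shows "g \<sim> T (wd g) @ Zs (hat g)"
  using assms
proof (induction g rule: hat.induct)
  case 1
  then show ?case by (auto intro: VA.eqv_refl)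
next
  case (2 b s g)
  have s: "s \<in> S" and g: "g \<in> VA.L" using 2 by auto
  note wS = wd_lists[OF g]
  define \<beta> where "\<beta> = (if b then alpha s else act M [s] (alpha s))"
  have \<beta>: "\<beta> \<in> roots S M" using s by (auto simp: \<beta>_def intro: alpha_roots refl_roots)
  let ?\<gamma> = "act M (rev (wd g)) \<beta>"
  have \<gamma>: "?\<gamma> \<in> roots S M" using wS \<beta> by (intro act_roots lists_rev)
  let ?Z = "Zs [(b, \<beta>)]"
  have L: "T [s] \<in> VA.L" "T (wd g) \<in> VA.L" "?Z \<in> VA.L" "Zs (hat g) \<in> VA.L"
    using s wS \<beta> g by (auto intro!: T_lists Zs_lists hat_lists zeta_word_lists inv_word_lists)
  have e: "[(b, Inl s)] \<sim> T [s] @ ?Z"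
    using sigma_eqv[OF s] by (cases b) (auto simp: \<beta>_def)
  have c: "?Z @ T (wd g) \<sim> T (wd g) @ Zs [(b, ?\<gamma>)]"
    using VA.eqv_sym[OF Zs_equivariant[OF wS, of "[(b, ?\<gamma>)]"]] \<gamma> \<beta> wS
    by (simp add: act_act_rev roots_V)
  have "[(b, Inl s)] @ g \<sim> (T [s] @ ?Z) @ (T (wd g) @ Zs (hat g))"
    by (rule VA.eqv_append[OF e 2(1)[OF g]])
  also have "(T [s] @ ?Z) @ (T (wd g) @ Zs (hat g)) = T [s] @ (?Z @ T (wd g)) @ Zs (hat g)"
    by (simp only: append_assoc)
  also have "\<dots> \<sim> T [s] @ (T (wd g) @ Zs [(b, ?\<gamma>)]) @ Zs (hat g)"
    by (rule VA.eqv_context[OF L(1,4) c])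
  finally show ?case by (simp add: \<beta>_def)
next
  case (3 b s g)
  have s: "s \<in> S" and g: "g \<in> VA.L" using 3 by auto
  have "[(b, Inr s)] \<sim> T [s]"
    using inv_T[of "[s]"] s by (cases b) (auto intro: VA.eqv_refl)
  from VA.eqv_append[OF this 3(1)[OF g]] show ?case by simp
qed

section \<open>The relations Z as the root parts of the Artin relations\<close>

lemma act_altword: "act M (altword s t k) = altR (Defs.refl M (alpha s)) (Defs.refl M (alpha t)) k"
proof (induction k arbitrary: s t)
  case (Suc k)
  have "act M (u @ v) = act M u \<circ> act M v" for u v by (auto simp: act_append)
  with Suc show ?case by simp
qed simp

lemma root_seq_simple:
  "root_seq M (alpha s) (alpha t) (Suc k) =
    act M (rev (altword t s k)) (alpha (if even k then s else t))"
  by (simp add: root_seq_def rev_altword act_altword)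

lemma wd_altword: "wd (pos (altword (Inl t) (Inl s) m)) = altword t s m"
  by (induction m arbitrary: s t) auto

text \<open>The letter with \<open>k\<close> letters to its right contributes the root numbered
  \<open>k + 1\<close>, so the Artin relation (v1) has exactly the relation Z of the simple roots as
  its root part.\<close>

lemma hat_altword: "hat (pos (altword (Inl t) (Inl s) m)) = Zword M (alpha t) (alpha s) m"
proof (induction m)
  case (Suc m)
  have "pos (altword (Inl t :: 's + 's) (Inl s) (Suc m)) =
      (True, Inl (if even m then s else t)) # pos (altword (Inl t) (Inl s) m)"
    by (simp add: altword_Suc_left del: altword.simps)
  then have "hat (pos (altword (Inl t) (Inl s) (Suc m))) =
      (True, root_seq M (alpha s) (alpha t) (Suc m)) # hat (pos (altword (Inl t) (Inl s) m))"
    by (simp only: hat.simps wd_altword root_seq_simple if_True)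
  then show ?case unfolding Suc.IH by (simp add: Zword_def)
qed (simp add: Zword_def)

lemma root_seq_act:
  assumes "w \<in> lists S" "\<beta> \<in> V" "\<gamma> \<in> V"
  shows "root_seq M (act M w \<beta>) (act M w \<gamma>) k = act M w (root_seq M \<beta> \<gamma> k)"
proof -
  have "altR (Defs.refl M (act M w b)) (Defs.refl M (act M w a)) j (act M w x)
      = act M w (altR (Defs.refl M b) (Defs.refl M a) j x)"
    if "b \<in> V" "a \<in> V" "x \<in> V" for a b x j
    using that by (induction j arbitrary: a b x) (auto simp: refl_act assms(1) refl_V)
  then show ?thesis using assms by (simp add: root_seq_def)
qed

lemma Zword_act:
  assumes "w \<in> lists S" "\<beta> \<in> V" "\<gamma> \<in> V"
  shows "Zword M (act M w \<gamma>) (act M w \<beta>) m = wmap w (Zword M \<gamma> \<beta> m)"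
  by (simp add: Zword_def wmap_def pos_def root_seq_act[OF assms] comp_def)

lemma bil_coeff_inj:
  assumes "s \<in> S" "t \<in> S" "s \<noteq> t" "s' \<in> S" "t' \<in> S" "s' \<noteq> t'"
    "M s t = enat m" "M s' t' = enat m'" "bil_coeff M s t = bil_coeff M s' t'"
  shows "m = m'"
proof -
  have m: "2 \<le> m" "2 \<le> m'" using assms M_enat_ge2 by blast+
  have "cos (pi / real m) = cos (pi / real m')" using assms by (simp add: bil_coeff_def)
  moreover have "0 \<le> pi / real n" "pi / real n \<le> pi" if "2 \<le> n" for n
    using that by (auto simp: divide_simps)
  ultimately have "pi / real m = pi / real m'" using m by (metis cos_inj_pi)
  then show ?thesis using m by (simp add: divide_simps)
qed

text \<open>The finite values of \<open>hatM\<close> as a relation, free of the choice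
  operator.\<close>

definition conn :: "('s \<Rightarrow> real) \<Rightarrow> ('s \<Rightarrow> real) \<Rightarrow> nat \<Rightarrow> bool" where
  "conn \<beta> \<gamma> m \<longleftrightarrow> (\<exists>w s t. w \<in> lists S \<and> s \<in> S \<and> t \<in> S \<and>
    \<beta> = act M w (alpha s) \<and> \<gamma> = act M w (alpha t) \<and> M s t = enat m)"

lemma connE:
  assumes "conn \<beta> \<gamma> m" "\<beta> \<noteq> \<gamma>"
  obtains w s t where "w \<in> lists S" "s \<in> S" "t \<in> S" "s \<noteq> t" "\<beta> = act M w (alpha s)"
    "\<gamma> = act M w (alpha t)" "M s t = enat m"
proof -
  have "\<exists>w s t. w \<in> lists S \<and> s \<in> S \<and> t \<in> S \<and>
    \<beta> = act M w (alpha s) \<and> \<gamma> = act M w (alpha t) \<and> M s t = enat m"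
    using assms(1) by (simp only: conn_def)
  then show thesis using that assms(2) by metis
qed

text \<open>W preserves the form, so \<open>bil M \<beta> \<gamma>\<close> equals -2 cos(pi/m) for
  every choice of \<open>w\<close>, \<open>s\<close>, \<open>t\<close>, and cosine is injective on
  [0, pi].\<close>

lemma conn_unique:
  assumes "conn \<beta> \<gamma> m" "conn \<beta> \<gamma> m'" "\<beta> \<noteq> \<gamma>" shows "m = m'"
proof -
  obtain w s t where 1: "w \<in> lists S" "s \<in> S" "t \<in> S" "s \<noteq> t" "\<beta> = act M w (alpha s)"
    "\<gamma> = act M w (alpha t)" "M s t = enat m" using connE[OF assms(1,3)] .
  obtain w' s' t' where 2: "w' \<in> lists S" "s' \<in> S" "t' \<in> S" "s' \<noteq> t'" "\<beta> = act M w' (alpha s')"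
    "\<gamma> = act M w' (alpha t')" "M s' t' = enat m'" using connE[OF assms(2,3)] .
  have "bil M \<beta> \<gamma> = bil_coeff M s t"
    unfolding 1(5,6) using 1(1-3) by (simp add: bil_act alpha_V bil_alpha)
  moreover have "bil M \<beta> \<gamma> = bil_coeff M s' t'"
    unfolding 2(5,6) using 2(1-3) by (simp add: bil_act alpha_V bil_alpha)
  ultimately show ?thesis by (intro bil_coeff_inj[OF 1(2-4) 2(2-4) 1(7) 2(7)]) simp
qed

lemma hatM_eq_enat:
  assumes "\<beta> \<noteq> \<gamma>" shows "hatM S M \<beta> \<gamma> = enat m \<longleftrightarrow> conn \<beta> \<gamma> m"
proof -
  have finite: "(\<exists>w s t. w \<in> lists S \<and> s \<in> S \<and> t \<in> S \<and> \<beta> = act M w (alpha s)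
      \<and> \<gamma> = act M w (alpha t) \<and> M s t \<noteq> \<infinity>) \<longleftrightarrow> (\<exists>n. conn \<beta> \<gamma> n)"
    unfolding conn_def not_infinity_eq by metis
  have val: "(\<exists>w s t. w \<in> lists S \<and> s \<in> S \<and> t \<in> S \<and> \<beta> = act M w (alpha s)
      \<and> \<gamma> = act M w (alpha t) \<and> M s t \<noteq> \<infinity> \<and> e = M s t) \<longleftrightarrow> (\<exists>n. e = enat n \<and> conn \<beta> \<gamma> n)" for e
    unfolding conn_def not_infinity_eq by metis
  have h: "hatM S M \<beta> \<gamma> = (if \<exists>n. conn \<beta> \<gamma> n then SOME e. \<exists>n. e = enat n \<and> conn \<beta> \<gamma> n else \<infinity>)"
    unfolding hatM_def finite val using assms by simp
  show ?thesis
  proof (cases "\<exists>n. conn \<beta> \<gamma> n")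
    case True
    then obtain n where n: "conn \<beta> \<gamma> n" by blast
    have "(SOME e. \<exists>n. e = enat n \<and> conn \<beta> \<gamma> n) = enat n"
      by (rule some_equality) (use n conn_unique[OF _ n assms] in blast)+
    then have "hatM S M \<beta> \<gamma> = enat n" using h True by simp
    then show ?thesis using n conn_unique[OF _ n assms] by (metis enat.inject)
  next
    case False
    then show ?thesis using h by simp
  qed
qed

text \<open>Together with \<open>PVAhat_relI\<close>: the defining relations are the W-translates of
  those for pairs of simple roots, hence a W-stable set.\<close>

lemma PVAhat_relE:
  assumes "(u, v) \<in> PVAhat_rels S M"
  obtains w s t m where "w \<in> lists S" "s \<in> S" "t \<in> S" "s \<noteq> t" "M s t = enat m"
    "u = wmap w (Zword M (alpha t) (alpha s) m)" "v = wmap w (Zword M (alpha s) (alpha t) m)"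
proof -
  obtain \<beta> \<gamma> m where b: "\<beta> \<noteq> \<gamma>" "hatM S M \<beta> \<gamma> = enat m" "u = Zword M \<gamma> \<beta> m" "v = Zword M \<beta> \<gamma> m"
    using assms unfolding PVAhat_rels_def by blast
  then obtain w s t where w: "w \<in> lists S" "s \<in> S" "t \<in> S" "s \<noteq> t"
    "\<beta> = act M w (alpha s)" "\<gamma> = act M w (alpha t)" "M s t = enat m"
    using connE[OF _ b(1), of m] hatM_eq_enat by metis
  show ?thesis by (rule that[OF w(1-4,7)]) (use b(3,4) w in \<open>simp_all add: Zword_act alpha_V\<close>)
qed

lemma PVAhat_relI:
  assumes "w \<in> lists S" "s \<in> S" "t \<in> S" "s \<noteq> t" "M s t = enat m"
  shows "(wmap w (Zword M (alpha t) (alpha s) m), wmap w (Zword M (alpha s) (alpha t) m))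
    \<in> PVAhat_rels S M"
proof -
  have ne: "act M w (alpha s) \<noteq> act M w (alpha t)"
    using assms by (simp add: act_inj alpha_V alpha_inj)
  then have "hatM S M (act M w (alpha s)) (act M w (alpha t)) = enat m"
    unfolding hatM_eq_enat[OF ne] conn_def using assms by metis
  moreover have "act M w (alpha s) \<in> roots S M" "act M w (alpha t) \<in> roots S M"
    using assms by (auto intro: act_roots alpha_roots)
  ultimately show ?thesis
    unfolding Zword_act[OF assms(1) alpha_V[OF assms(2)] alpha_V[OF assms(3)], symmetric]
      Zword_act[OF assms(1) alpha_V[OF assms(3)] alpha_V[OF assms(2)], symmetric] PVAhat_rels_def
    using ne by blast
qed

text \<open>For simple roots, compare the normal forms of the two sides of (v1): their \<tau> parts
  agree by the braid relation and cancel. Conjugation by \<open>T w\<close> gives the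
  translates.\<close>

lemma Zs_rels:
  assumes "(u, v) \<in> PVAhat_rels S M" shows "Zs u \<sim> Zs v"
proof -
  obtain w s t m where w: "w \<in> lists S" "s \<in> S" "t \<in> S" "s \<noteq> t" "M s t = enat m"
    "u = wmap w (Zword M (alpha t) (alpha s) m)" "v = wmap w (Zword M (alpha s) (alpha t) m)"
    using PVAhat_relE[OF assms] .
  let ?g = "pos (altword (Inl t) (Inl s) m)" and ?h = "pos (altword (Inl s) (Inl t) m)"
  let ?a = "Zword M (alpha t) (alpha s) m" and ?b = "Zword M (alpha s) (alpha t) m"
  have gh: "?g \<sim> ?h" using w by (intro VA.eqv_rel VA_relsI)
  have ab: "?a \<in> Hat.L" "?b \<in> Hat.L" using w by (auto intro: Zword_lists alpha_roots)
  have L: "T w \<in> VA.L" "T (altword t s m) \<in> VA.L" "Zs ?a \<in> VA.L" "Zs ?b \<in> VA.L" "Zs u \<in> VA.L" "Zs v \<in> VA.L"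
    using w ab by (auto intro!: T_lists altword_lists Zs_lists wmap_lists)
  have "T (altword t s m) @ Zs ?a \<sim> ?g"
    using VA.eqv_sym[OF normal_form[of ?g]] VA.eqv_lists[OF gh] by (simp add: hat_altword wd_altword)
  also note gh
  also have "?h \<sim> T (altword s t m) @ Zs ?b"
    using normal_form[of ?h] VA.eqv_lists[OF gh] by (simp add: hat_altword wd_altword)
  also have "\<dots> \<sim> T (altword t s m) @ Zs ?b"
    by (rule VA.eqv_right[OF L(4) VA.eqv_sym[OF coxeq_VA[OF ce_braid[OF w(2-5)]]]])
  finally have "Zs ?a \<sim> Zs ?b" by (rule VA.eqv_cancel_left[OF L(2-4)])
  from VA.eqv_left[OF L(1) this] have ab': "T w @ Zs ?a \<sim> T w @ Zs ?b" .
  have "Zs u @ T w \<sim> T w @ Zs ?a" unfolding w(6) by (rule VA.eqv_sym[OF Zs_equivariant[OF w(1) ab(1)]])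
  also note ab'
  also have "T w @ Zs ?b \<sim> Zs v @ T w" unfolding w(7) by (rule Zs_equivariant[OF w(1) ab(2)])
  finally show ?thesis by (rule VA.eqv_cancel_right[OF L(1,5,6)])
qed

lemma wmap_eqv:
  assumes "w \<in> lists S" "Hat.eqv u v" shows "Hat.eqv (wmap w u) (wmap w v)"
  using assms(2) unfolding Hat.eqv_def
proof (induction rule: pres_rel.induct)
  case (pr_refl u)
  then show ?case using assms(1) by (intro pres_rel.pr_refl wmap_lists)
next
  case (pr_cancel x b)
  then show ?case using assms(1) by (auto intro!: pres_rel.pr_cancel act_roots)
next
  case (pr_rel u v)
  then obtain w' s t m where w: "w' \<in> lists S" "s \<in> S" "t \<in> S" "s \<noteq> t" "M s t = enat m"
    "u = wmap w' (Zword M (alpha t) (alpha s) m)" "v = wmap w' (Zword M (alpha s) (alpha t) m)"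
    by (rule PVAhat_relE)
  then show ?case using PVAhat_relI[of "w @ w'" s t m] assms(1) by (auto intro: pres_rel.pr_rel)
next
  case (pr_concat u v u' v')
  then show ?case by (simp add: pres_rel.pr_concat)
qed (blast intro: pres_rel.pr_sym pres_rel.pr_trans)+

lemma act_rev_cong:
  assumes "u \<in> lists S" "v \<in> lists S" "\<And>x. x \<in> V \<Longrightarrow> act M u x = act M v x" "x \<in> V"
  shows "act M (rev u) x = act M (rev v) x"
proof -
  have "act M (rev u) x = act M (rev u) (act M v (act M (rev v) x))"
    using assms by (simp add: act_act_rev)
  also have "\<dots> = act M (rev v) x"
    using assms by (simp add: assms(3)[symmetric] act_rev_act act_V lists_rev)
  finally show ?thesis .
qed

text \<open>(v1) yields a defining relation of the group on the roots, (v2) and the squares have no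
  root part, and in (v3) both sides have the single root \<alpha>_s.\<close>

lemma hat_rels:
  assumes "(g, h) \<in> VA_rels S M"
  shows "Hat.eqv (hat g) (hat h) \<and> (\<forall>x\<in>V. act M (wd g) x = act M (wd h) x)"
proof -
  have nil: "Hat.eqv [] []" by (simp add: Hat.eqv_refl)
  consider
    (v1) s t m where "s \<in> S" "t \<in> S" "s \<noteq> t" "M s t = enat m"
      "g = pos (altword (Inl t) (Inl s) m)" "h = pos (altword (Inl s) (Inl t) m)"
  | (v2) s t m where "s \<in> S" "t \<in> S" "s \<noteq> t" "M s t = enat m"
      "g = T (altword t s m)" "h = T (altword s t m)"
  | (sq) s where "s \<in> S" "g = T [s, s]" "h = []"
  | (v3) s t m where "s \<in> S" "t \<in> S" "s \<noteq> t" "M s t = enat m"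
      "g = T (altword s t (m - 1)) @ [(True, Inl s)]"
      "h = (True, Inl (if even m then s else t)) # T (altword s t (m - 1))"
    using assms unfolding VA_rels_def by (auto simp: map_altword)
  then show ?thesis
  proof cases
    case v1
    then have "(hat g, hat h) \<in> PVAhat_rels S M"
      using PVAhat_relI[of "[]" s t m] by (simp add: hat_altword wmap_def)
    with v1 show ?thesis by (simp add: Hat.eqv_rel wd_altword act_braid)
  next
    case v2
    then show ?thesis by (simp add: nil act_braid del: map_altword)
  next
    case sq
    then show ?thesis using nil by (simp add: refl_refl alpha_V bil_alpha_same)
  next
    case v3
    let ?A = "altword s t (m - 1)" and ?r = "if even m then s else t"
    have A: "?A \<in> lists S" using v3 by (intro altword_lists)
    note e = act_altword_end[OF v3(1-4)]
    \<comment> \<open>On the right of (v3) the \<sigma> letter precedes the alternating word, whose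
      inverse carries its root back to \<alpha>_s.\<close>
    have "act M (rev ?A) (alpha ?r) = alpha s"
      by (rule act_rev_act[OF A alpha_V[OF v3(1)], unfolded e])
    then have "hat g = [(True, alpha s)]" "hat h = [(True, alpha s)]"
      by (simp_all add: v3(5,6) hat_append)
    moreover have "wd g = ?A @ [s]" "wd h = ?r # ?A" by (simp_all add: v3(5,6))
    ultimately show ?thesis
      using act_conj[OF A v3(1) e] v3(1) by (auto intro!: Hat.eqv_refl alpha_roots simp del: act.simps)
  qed
qed

text \<open>The two claims are proved together: by the cocycle identity the root part of a product
  also involves the W part of its right factor.\<close>

lemma hat_eqv:
  assumes "g \<sim> h"
  shows "Hat.eqv (hat g) (hat h) \<and> (\<forall>x\<in>V. act M (wd g) x = act M (wd h) x)"
  using assms unfolding VA.eqv_def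
proof (induction rule: pres_rel.induct)
  case (pr_refl w)
  then show ?case by (simp add: Hat.eqv_refl hat_lists)
next
  case (pr_sym u v)
  then show ?case by (auto intro: Hat.eqv_sym)
next
  case (pr_trans u v w)
  then show ?case by (auto intro: Hat.eqv_trans)
next
  case (pr_cancel x b)
  then show ?case
  proof (elim UnE imageE)
    \<comment> \<open>The two letters always carry the same root: -\<alpha>_s if \<sigma>_s comes
      first, \<alpha>_s if its inverse does.\<close>
    fix s assume s: "x = Inl s" "s \<in> S"
    have "Hat.eqv (hat [(b, x), (\<not> b, x)]) []"
      using s Hat.eqv_cancel[of "alpha s" False] Hat.eqv_cancel[of "act M [s] (alpha s)" True]
      by (cases b) (auto simp: alpha_roots refl_roots refl_refl alpha_V bil_alpha_same)
    with s show ?thesis by (simp add: refl_refl alpha_V bil_alpha_same wd_def)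
  next
    fix s assume s: "x = Inr s" "s \<in> S"
    then show ?thesis by (simp add: refl_refl alpha_V bil_alpha_same wd_def Hat.eqv_refl)
  qed
next
  case (pr_rel u v)
  then show ?case by (rule hat_rels)
next
  case (pr_concat u v u' v')
  have L: "u \<in> VA.L" "v \<in> VA.L" "u' \<in> VA.L" "v' \<in> VA.L"
    using pr_concat(1,2) VA.eqv_lists by (auto simp: VA.eqv_def)
  note wS = L[THEN wd_lists]
  have "wmap (rev (wd u')) (hat v) = wmap (rev (wd v')) (hat v)"
    using act_rev_cong[OF wS(3,4)] pr_concat.IH(2) hat_lists[OF L(2)] by (intro wmap_cong) auto
  moreover have "Hat.eqv (wmap (rev (wd u')) (hat u)) (wmap (rev (wd u')) (hat v))"
    using pr_concat.IH(1) wS by (intro wmap_eqv lists_rev) auto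
  ultimately have "Hat.eqv (hat (u @ u')) (hat (v @ v'))"
    unfolding hat_append using pr_concat.IH(2) by (intro Hat.eqv_append) auto
  moreover have "act M (wd (u @ u')) x = act M (wd (v @ v')) x" if "x \<in> V" for x
    using pr_concat.IH that act_V[OF wS(4) that] by (simp add: act_append)
  ultimately show ?case by blast
qed

lemma hat_zeta_word:
  assumes "\<beta> \<in> roots S M"
  shows "hat (zt \<beta>) = [(True, \<beta>)]" "hat (inv_word (zt \<beta>)) = [(False, \<beta>)]"
    and "x \<in> V \<Longrightarrow> act M (wd (zt \<beta>)) x = x"
proof -
  obtain w s where w: "w \<in> lists S" "s \<in> S" "act M w (alpha s) = \<beta>"
    "zt \<beta> = T w @ \<xi> s @ inv_word (T w)" using zeta_word_choice[OF assms] .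
  then show "hat (zt \<beta>) = [(True, \<beta>)]" "hat (inv_word (zt \<beta>)) = [(False, \<beta>)]"
    by (simp_all add: hat_append act_append refl_refl alpha_V bil_alpha_same)
  show "act M (wd (zt \<beta>)) x = x" if "x \<in> V"
    using w that by (simp add: act_append refl_refl alpha_V bil_alpha_same act_V lists_rev act_act_rev)
qed

lemma act_wd_Zs:
  assumes "u \<in> Hat.L" "x \<in> V" shows "act M (wd (Zs u)) x = x" "act M (rev (wd (Zs u))) x = x"
proof -
  have rev: "act M (rev (wd (zt \<beta>))) x = x" if "\<beta> \<in> roots S M" "x \<in> V" for \<beta> x
    using act_rev_cong[of "wd (zt \<beta>)" "[]" x] that hat_zeta_word(3) wd_lists[OF zeta_word_lists] by simp
  have 1: "act M (wd (Zs u)) x = x" if "x \<in> V" for x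
    using assms(1) by (induction u rule: list.induct) (auto simp: act_append hat_zeta_word rev that)
  then show "act M (wd (Zs u)) x = x" using assms(2) .
  show "act M (rev (wd (Zs u))) x = x"
    using act_rev_cong[of "wd (Zs u)" "[]" x] wd_lists[OF Zs_lists[OF assms(1)]] 1 assms(2) by simp
qed

text \<open>The words \<zeta> act trivially on V, so the cocycle identity leaves the earlier letters
  unchanged. Hence \<open>hat\<close> is a left inverse of the substitution.\<close>

lemma hat_Zs: "u \<in> Hat.L \<Longrightarrow> hat (Zs u) = u"
proof (induction u)
  case (Cons z u)
  then show ?case
    by (cases z) (auto simp: hat_append hat_zeta_word act_wd_Zs roots_V)
qed simp

section \<open>The projection onto W, its kernel, and the isomorphism\<close>

abbreviation "proj \<equiv> (\<lambda>x :: 's + 's. case x of Inl s \<Rightarrow> pos [s] | Inr s \<Rightarrow> pos [s])"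

lemma word_subst_proj: "g \<in> VA.L \<Longrightarrow> W.eqv (word_subst proj g) (pos (wd g))"
proof (induction g)
  case Nil
  then show ?case by (simp add: W.eqv_refl)
next
  case (Cons z g)
  obtain b x where z: "z = (b, x)" by (cases z)
  obtain s where s: "s \<in> S" "x = Inl s \<or> x = Inr s" using Cons.prems by (auto simp: z)
  have sL: "[(True, s)] \<in> W.L" "[(False, s)] \<in> W.L" using s by auto
  have "W.eqv ([(True, s)] @ [(True, s)]) []" using coxeq_W[OF ce_square[OF s(1)]] by simp
  moreover have "W.eqv ([(True, s)] @ [(False, s)]) []" using W.eqv_cancel[OF s(1), of True] by simp
  ultimately have "W.eqv ([(True, s)] @ [(False, s)]) ([(True, s)] @ [(True, s)])"
    using W.eqv_sym W.eqv_trans by blast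
  then have "W.eqv [(False, s)] [(True, s)]" by (rule W.eqv_cancel_left[OF sL(1) sL(2) sL(1)])
  then have "W.eqv [(b, s)] [(True, s)]" using W.eqv_refl[OF sL(1)] by (cases b) auto
  then have "W.eqv ([(b, s)] @ word_subst proj g) ([(True, s)] @ pos (wd g))"
    using Cons by (intro W.eqv_append) auto
  with s z show ?case by (cases b) auto
qed

text \<open>\<open>map snd\<close> forgets the signs of letters, which is harmless as each generator
  acts as an involution.\<close>

lemma W_eqv_act: "W.eqv u v \<Longrightarrow> x \<in> V \<Longrightarrow> act M (map snd u) x = act M (map snd v) x"
  unfolding W.eqv_def
proof (induction arbitrary: x rule: pres_rel.induct)
  case (pr_concat u v u' v')
  have "map snd v' \<in> lists S"
    using W.eqv_lists[of u' v'] pr_concat(2) by (fastforce simp: W.eqv_def in_lists_conv_set)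
  with pr_concat show ?case by (simp add: act_append act_V)
next
  case (pr_rel u v)
  then show ?case
    by (auto simp: W_rels_def pos_def comp_def act_braid refl_refl alpha_V bil_alpha_same)
qed (auto simp: refl_refl alpha_V bil_alpha_same)

text \<open>Faithfulness lets equality in W be tested by the action on V, the form in which
  \<open>hat_eqv\<close> delivers it.\<close>

lemma proj_eqv:
  assumes "g \<in> VA.L" "h \<in> VA.L"
  shows "W.eqv (word_subst proj g) (word_subst proj h) \<longleftrightarrow> (\<forall>x\<in>V. act M (wd g) x = act M (wd h) x)"
proof
  assume "W.eqv (word_subst proj g) (word_subst proj h)"
  then have "W.eqv (pos (wd g)) (pos (wd h))"
    using word_subst_proj assms W.eqv_trans W.eqv_sym by meson
  from W_eqv_act[OF this] show "\<forall>x\<in>V. act M (wd g) x = act M (wd h) x"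
    by (simp add: pos_def comp_def)
next
  assume "\<forall>x\<in>V. act M (wd g) x = act M (wd h) x"
  then have "W.eqv (pos (wd g)) (pos (wd h))"
    using assms by (intro coxeq_W faithful wd_lists) auto
  then show "W.eqv (word_subst proj g) (word_subst proj h)"
    using word_subst_proj assms W.eqv_trans W.eqv_sym by meson
qed

lemma piP_cls:
  assumes "g \<in> VA.L" shows "piP S M (VA.cls g) = W.cls (word_subst proj g)"
  unfolding piP_def
proof (rule induced_map_cls[OF VA_presentation W_presentation assms])
  fix g h assume "g \<sim> h"
  with hat_eqv[OF this] VA.eqv_lists[OF this] proj_eqv
  show "W.eqv (word_subst proj g) (word_subst proj h)" by blast
qed

lemma mem_PVA:
  assumes "g \<in> VA.L"
  shows "VA.cls g \<in> carrier (PVA_grp S M) \<longleftrightarrow> (\<forall>x\<in>V. act M (wd g) x = x)"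
proof -
  have "VA.cls g \<in> carrier (PVA_grp S M) \<longleftrightarrow> W.cls (word_subst proj g) = W.cls []"
    using assms by (auto simp: PVA_grp_def kernel_def VA_grp_def W_grp_def VA.carrier_presented
        W.one_presented piP_cls)
  also have "\<dots> \<longleftrightarrow> W.eqv (word_subst proj g) (word_subst proj [])"
    using W.cls_eq[of _ "[]"] W.eqv_lists[OF word_subst_proj[OF assms]] word_subst_simps(1) by metis
  also have "\<dots> \<longleftrightarrow> (\<forall>x\<in>V. act M (wd g) x = x)" unfolding proj_eqv[OF assms lists.Nil] by simp
  finally show ?thesis .
qed

lemma PVAhat_map_cls:
  assumes "u \<in> Hat.L" shows "PVAhat_map S M (Hat.cls u) = VA.cls (Zs u)"
  unfolding PVAhat_map_def
  by (rule induced_map_cls[OF PVAhat_presentation VA_presentation assms])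
     (rule word_subst_eqv[OF PVAhat_presentation VA_presentation zeta_word_lists Zs_rels])

lemma PVAhat_map_iso: "PVAhat_map S M \<in> iso (PVAhat_grp S M) (PVA_grp S M)"
proof -
  have G: "carrier (PVAhat_grp S M) = Hat.cls ` Hat.L"
    by (simp add: PVAhat_grp_def Hat.carrier_presented)
  have mem: "VA.cls (Zs u) \<in> carrier (PVA_grp S M)" if "u \<in> Hat.L" for u
    using that by (simp add: mem_PVA Zs_lists act_wd_Zs)
  have mult: "mult (PVA_grp S M) (VA.cls (Zs u)) (VA.cls (Zs v)) = VA.cls (Zs (u @ v))"
    if "u \<in> Hat.L" "v \<in> Hat.L" for u v
    using that by (simp add: PVA_grp_def VA_grp_def VA.mult_presented Zs_lists)
  have hat_mult: "mult (PVAhat_grp S M) (Hat.cls u) (Hat.cls v) = Hat.cls (u @ v)"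
    if "u \<in> Hat.L" "v \<in> Hat.L" for u v
    using that by (simp add: PVAhat_grp_def Hat.mult_presented)
  have "PVAhat_map S M \<in> hom (PVAhat_grp S M) (PVA_grp S M)"
    unfolding hom_def G
    by (auto simp: PVAhat_map_cls mem mult hat_mult)
  moreover have "bij_betw (PVAhat_map S M) (carrier (PVAhat_grp S M)) (carrier (PVA_grp S M))"
    unfolding bij_betw_def
  proof
    show "inj_on (PVAhat_map S M) (carrier (PVAhat_grp S M))"
      unfolding G
    proof (rule inj_onI, elim imageE)
      fix A B u v assume u: "A = Hat.cls u" "u \<in> Hat.L" and v: "B = Hat.cls v" "v \<in> Hat.L"
        and "PVAhat_map S M A = PVAhat_map S M B"
      then have "Zs u \<sim> Zs v" by (simp add: PVAhat_map_cls VA.cls_eq Zs_lists)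
      then have "Hat.eqv u v" using hat_eqv[of "Zs u" "Zs v"] u v by (simp add: hat_Zs)
      then show "A = B" using u v by (simp add: Hat.cls_eq)
    qed
    have "\<exists>u\<in>Hat.L. A = VA.cls (Zs u)" if A: "A \<in> carrier (PVA_grp S M)" for A
    proof -
      obtain g where g: "g \<in> VA.L" "A = VA.cls g"
        using A by (auto simp: PVA_grp_def kernel_def VA_grp_def VA.carrier_presented)
      \<comment> \<open>Surjectivity: an element of the kernel has trivial W part, so the \<tau>
        factor of its normal form disappears.\<close>
      have "wd g \<approx> []" using A g mem_PVA by (intro act_id_coxeq_Nil wd_lists) auto
      from VA.eqv_right[OF Zs_lists[OF hat_lists[OF g(1)]] coxeq_VA[OF this]]
      have "T (wd g) @ Zs (hat g) \<sim> Zs (hat g)" by simp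
      with normal_form[OF g(1)] have "g \<sim> Zs (hat g)" using VA.eqv_trans by blast
      with g show ?thesis using hat_lists VA.cls_eq by blast
    qed
    then show "PVAhat_map S M ` carrier (PVAhat_grp S M) = carrier (PVA_grp S M)"
      unfolding G image_image using mem by (auto simp: PVAhat_map_cls)
  qed
  ultimately show ?thesis by (simp add: iso_def)
qed

end

theorem theorem2p6:
  fixes S :: "'s set" and M :: "'s \<Rightarrow> 's \<Rightarrow> enat"
  assumes "countable S" and "coxeter_matrix S M"
  shows "PVAhat_map S M \<in> iso (PVAhat_grp S M) (PVA_grp S M)"
  using coxeter.PVAhat_map_iso[OF coxeter.intro[OF assms(2)]] .

end
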